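(* Let $M^3$ be a connected $3$-dimensional paracontact metric manifold with paracontact metric structure $(\varphi,\xi,\eta,g)$, and let $Q$ be the Ricci operator of $g$. Suppose that $Q\varphi=\varphi Q$ on $M^3$. Then at least one of the following holds: (i) $\operatorname{tr} h^2=0$ everywhere on $M^3$, where $h=\frac12\mathcal{L}_\xi\varphi$; (ii) $g$ is flat; (iii) there is a real constant $k\neq -1$ such that $M^3$ has constant $\xi$-sectional curvature $k$ and constant $\varphi$-sectional curvature $-k$ (so $-k\neq 1$); that is, for every point $p\in M^3$ and every $X\in T_pM^3$ with $X\perp\xi$ and $g(X,X)=\pm1$, one has $K(\xi,X)=k$ and $K(X,\varphi X)=-k$.
   Context: All manifolds are $C^\infty$ and connected. A manifold $M^{2n+1}$ is a paracontact manifold if it carries a global $1$-form $\eta$ with $\eta\wedge(d\eta)^n\neq0$ everywhere (here $n=1$). Its characteristic vector field $\xi$ is the unique vector field with $\eta(\xi)=1$ and $d\eta(\xi,X)=0$ for all vector fields $X$. A pseudo-Riemannian metric $g$ is an associated metric if there is a $(1,1)$-tensor field $\varphi$ such that, for all vector fields $X,Y$, $$d\eta(X,Y)=g(X,\varphi Y),\qquad \eta(X)=g(X,\xi),\qquad \varphi^2=\mathrm{Id}-\eta\otimes\xi .$$ Here the exterior derivative is normalized by $d\eta(X,Y)=\frac12\big(X\eta(Y)-Y\eta(X)-\eta([X,Y])\big)$. Then $(\varphi,\xi,\eta,g)$ is called a paracontact metric structure, and $M$ with it a paracontact metric manifold. It follows that $\varphi\xi=0$, $\eta\circ\varphi=0$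 and $g(\varphi X,\varphi Y)=-g(X,Y)+\eta(X)\eta(Y)$. Let $\nabla$ be the Levi-Civita connection of $g$, $R(X,Y)Z=\nabla_X\nabla_YZ-\nabla_Y\nabla_XZ-\nabla_{[X,Y]}Z$ the curvature tensor, and $R(X,Y,Z,W)=g(R(X,Y)Z,W)$. The Ricci operator $Q$ is defined by $g(QY,Z)=\operatorname{tr}\{X\mapsto R(X,Y)Z\}$. The $(1,1)$-tensor $h$ is $h=\frac12\mathcal{L}_\xi\varphi$, where $\mathcal{L}$ is the Lie derivative, and $\operatorname{tr}$ denotes the trace of an endomorphism. For $X\perp\xi$ with $g(X,X)=\epsilon_X=\pm1$, the $\xi$-sectional curvature is $K(\xi,X)=\epsilon_X R(X,\xi,\xi,X)$, i.e. the sectional curvature of the plane spanned by $\xi$ and $X$; the $\varphi$-sectional curvature is $K(X,\varphi X)=-R(X,\varphi X,\varphi X,X)$, i.e. the sectional curvature of the plane spanned by $X$ and $\varphi X$ (note $g(\varphi X,\varphi X)=-g(X,X)$). *)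

theory Defs
  imports "HOL-Analysis.Analysis"
begin

primrec C_k_on :: "nat \<Rightarrow> ('a::real_normed_vector \<Rightarrow> 'b::real_normed_vector) \<Rightarrow> 'a set \<Rightarrow> bool"
where
  "C_k_on 0 f S \<longleftrightarrow> continuous_on S f"
| "C_k_on (Suc k) f S \<longleftrightarrow>
     (\<forall>x\<in>S. f differentiable (at x)) \<and>
     (\<forall>v. C_k_on k (\<lambda>x. frechet_derivative f (at x) v) S)"

text \<open>Used only for open sets and for a finite-dimensional domain, where it is the usual
  notion of a map of class \<open>C\<^sup>\<infinity>\<close>.\<close>

definition smooth_on :: "'a::real_normed_vector set \<Rightarrow> ('a \<Rightarrow> 'b::real_normed_vector) \<Rightarrow> bool"
  where "smooth_on S f \<longleftrightarrow> (\<forall>k. C_k_on k f S)"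

text \<open>A chart is a pair of its domain and its coordinate map; the values of the map outside
  the domain are irrelevant.\<close>

type_synonym ('a, 'n) chart = "'a set \<times> ('a \<Rightarrow> real ^ 'n)"

definition chart_image :: "('a, 'n) chart \<Rightarrow> (real ^ 'n) set"
  where "chart_image c = snd c ` fst c"

definition overlap :: "('a, 'n) chart \<Rightarrow> ('a, 'n) chart \<Rightarrow> (real ^ 'n) set"
  where "overlap c d = snd c ` (fst c \<inter> fst d)"

definition transition :: "('a, 'n) chart \<Rightarrow> ('a, 'n) chart \<Rightarrow> real ^ 'n \<Rightarrow> real ^ 'n"
  where "transition c d x = snd d (inv_into (fst c) (snd c) x)"

definition jacobian_at ::
    "('a, 'n::finite) chart \<Rightarrow> ('a, 'n) chart \<Rightarrow> real ^ 'n \<Rightarrow> real ^ 'n ^ 'n"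
  where "jacobian_at c d x = matrix (frechet_derivative (transition c d) (at x))"

definition smooth_manifold :: "'a topology \<Rightarrow> ('a, 'n::finite) chart set \<Rightarrow> bool"
  where "smooth_manifold M A \<longleftrightarrow>
    Hausdorff_space M \<and> second_countable M \<and>
    topspace M = (\<Union>c\<in>A. fst c) \<and>
    (\<forall>c\<in>A. openin M (fst c) \<and> open (chart_image c) \<and>
       homeomorphic_map (subtopology M (fst c)) (top_of_set (chart_image c)) (snd c)) \<and>
    (\<forall>c\<in>A. \<forall>d\<in>A. smooth_on (overlap c d) (transition c d))"

text \<open>A tensor field on the manifold is given by its smooth components in every chart of the
  atlas, as functions of the coordinates \<open>x \<in> chart_image c\<close>, subject to the
  transformation law of its type. In the chart \<open>c\<close> the tangent space at the point with
  coordinates \<open>x\<close> is \<open>real ^ 'n\<close>, with respect to the coordinate basis.\<close>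

definition vector_field ::
    "('a, 'n::finite) chart set \<Rightarrow> (('a, 'n) chart \<Rightarrow> real ^ 'n \<Rightarrow> real ^ 'n) \<Rightarrow> bool"
  where "vector_field A X \<longleftrightarrow>
    (\<forall>c\<in>A. smooth_on (chart_image c) (X c)) \<and>
    (\<forall>c\<in>A. \<forall>d\<in>A. \<forall>x\<in>overlap c d. X d (transition c d x) = jacobian_at c d x *v X c x)"

definition one_form ::
    "('a, 'n::finite) chart set \<Rightarrow> (('a, 'n) chart \<Rightarrow> real ^ 'n \<Rightarrow> real ^ 'n) \<Rightarrow> bool"
  where "one_form A \<alpha> \<longleftrightarrow>
    (\<forall>c\<in>A. smooth_on (chart_image c) (\<alpha> c)) \<and>
    (\<forall>c\<in>A. \<forall>d\<in>A. \<forall>x\<in>overlap c d. \<alpha> c x = \<alpha> d (transition c d x) v* jacobian_at c d x)"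

definition endomorphism_field ::
    "('a, 'n::finite) chart set \<Rightarrow> (('a, 'n) chart \<Rightarrow> real ^ 'n \<Rightarrow> real ^ 'n ^ 'n) \<Rightarrow> bool"
  where "endomorphism_field A T \<longleftrightarrow>
    (\<forall>c\<in>A. smooth_on (chart_image c) (T c)) \<and>
    (\<forall>c\<in>A. \<forall>d\<in>A. \<forall>x\<in>overlap c d.
       T d (transition c d x) ** jacobian_at c d x = jacobian_at c d x ** T c x)"

text \<open>The value of the 1-form with components \<open>a\<close> on the vector \<open>v\<close> is \<open>a \<bullet> v\<close>, and that of
  the bilinear form with Gram matrix \<open>G\<close> on \<open>v\<close> and \<open>w\<close> is \<open>bilin G v w\<close>.\<close>

definition bilin :: "real ^ 'n::finite ^ 'n \<Rightarrow> real ^ 'n \<Rightarrow> real ^ 'n \<Rightarrow> real"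
  where "bilin G v w = v \<bullet> (G *v w)"

definition pseudo_riemannian_metric ::
    "('a, 'n::finite) chart set \<Rightarrow> (('a, 'n) chart \<Rightarrow> real ^ 'n \<Rightarrow> real ^ 'n ^ 'n) \<Rightarrow> bool"
  where "pseudo_riemannian_metric A g \<longleftrightarrow>
    (\<forall>c\<in>A. smooth_on (chart_image c) (g c)) \<and>
    (\<forall>c\<in>A. \<forall>d\<in>A. \<forall>x\<in>overlap c d.
       g c x = transpose (jacobian_at c d x) ** g d (transition c d x) ** jacobian_at c d x) \<and>
    (\<forall>c\<in>A. \<forall>x\<in>chart_image c.
       (\<forall>v w. bilin (g c x) v w = bilin (g c x) w v) \<and>
       (\<forall>v. (\<forall>w. bilin (g c x) v w = 0) \<longrightarrow> v = 0))"

text \<open>Below, \<open>X\<close>, \<open>Y\<close>, \<open>Z\<close> are local vector fields, defined on the image of a chart.\<close>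

text \<open>The derivative of a function (or, componentwise, of a vector field) along \<open>X\<close>.\<close>

definition dir_deriv ::
    "(real ^ 'n \<Rightarrow> real ^ 'n::finite) \<Rightarrow> (real ^ 'n \<Rightarrow> 'b::real_normed_vector) \<Rightarrow> real ^ 'n \<Rightarrow> 'b"
  where "dir_deriv X f x = frechet_derivative f (at x) (X x)"

definition lie_bracket ::
    "(real ^ 'n \<Rightarrow> real ^ 'n::finite) \<Rightarrow> (real ^ 'n \<Rightarrow> real ^ 'n) \<Rightarrow> real ^ 'n \<Rightarrow> real ^ 'n"
  where "lie_bracket X Y x = dir_deriv X Y x - dir_deriv Y X x"

definition ext_deriv ::
    "(real ^ 'n \<Rightarrow> real ^ 'n::finite) \<Rightarrow> (real ^ 'n \<Rightarrow> real ^ 'n) \<Rightarrow> (real ^ 'n \<Rightarrow> real ^ 'n) \<Rightarrow>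
     real ^ 'n \<Rightarrow> real"
  where "ext_deriv \<alpha> X Y x =
    (1/2) * (dir_deriv X (\<lambda>y. \<alpha> y \<bullet> Y y) x - dir_deriv Y (\<lambda>y. \<alpha> y \<bullet> X y) x
             - \<alpha> x \<bullet> lie_bracket X Y x)"

text \<open>The 3-form \<open>\<alpha> \<and> d\<alpha>\<close>. The factor 1/3 is the wedge normalisation that goes with the factor
  1/2 in \<open>ext_deriv\<close>.\<close>

definition wedge_ext_deriv ::
    "(real ^ 'n \<Rightarrow> real ^ 'n::finite) \<Rightarrow> (real ^ 'n \<Rightarrow> real ^ 'n) \<Rightarrow> (real ^ 'n \<Rightarrow> real ^ 'n) \<Rightarrow>
     (real ^ 'n \<Rightarrow> real ^ 'n) \<Rightarrow> real ^ 'n \<Rightarrow> real"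
  where "wedge_ext_deriv \<alpha> X Y Z x =
    (1/3) * ((\<alpha> x \<bullet> X x) * ext_deriv \<alpha> Y Z x + (\<alpha> x \<bullet> Y x) * ext_deriv \<alpha> Z X x
             + (\<alpha> x \<bullet> Z x) * ext_deriv \<alpha> X Y x)"

definition lie_deriv_endo ::
    "(real ^ 'n \<Rightarrow> real ^ 'n::finite) \<Rightarrow> (real ^ 'n \<Rightarrow> real ^ 'n ^ 'n) \<Rightarrow>
     (real ^ 'n \<Rightarrow> real ^ 'n) \<Rightarrow> real ^ 'n \<Rightarrow> real ^ 'n"
  where "lie_deriv_endo V T X x =
    lie_bracket V (\<lambda>y. T y *v X y) x - T x *v lie_bracket V X x"

text \<open>An operator \<open>F\<close> on vector fields that is linear over the smooth functions gives an
  endomorphism of each tangent space: extend \<open>v\<close> to a vector field, apply \<open>F\<close>, evaluate at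
  \<open>x\<close>. The result does not depend on the extension; the one with constant components is used.\<close>

definition endo_at ::
    "((real ^ 'n \<Rightarrow> real ^ 'n::finite) \<Rightarrow> real ^ 'n \<Rightarrow> real ^ 'n) \<Rightarrow> real ^ 'n \<Rightarrow> real ^ 'n ^ 'n"
  where "endo_at F x = matrix (\<lambda>v. F (\<lambda>_. v) x)"

definition h_tensor ::
    "(real ^ 'n \<Rightarrow> real ^ 'n::finite ^ 'n) \<Rightarrow> (real ^ 'n \<Rightarrow> real ^ 'n) \<Rightarrow> real ^ 'n \<Rightarrow> real ^ 'n ^ 'n"
  where "h_tensor \<phi> \<xi> x = (1/2) *\<^sub>R endo_at (lie_deriv_endo \<xi> \<phi>) x"

type_synonym 'n connection =
  "(real ^ 'n \<Rightarrow> real ^ 'n) \<Rightarrow> (real ^ 'n \<Rightarrow> real ^ 'n) \<Rightarrow> real ^ 'n \<Rightarrow> real ^ 'n"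

definition affine_connection_on :: "(real ^ 'n::finite) set \<Rightarrow> 'n connection \<Rightarrow> bool"
  where "affine_connection_on S D \<longleftrightarrow>
    (\<forall>X Y. smooth_on S X \<longrightarrow> smooth_on S Y \<longrightarrow> smooth_on S (D X Y)) \<and>
    (\<forall>X X' Y. smooth_on S X \<longrightarrow> smooth_on S X' \<longrightarrow> smooth_on S Y \<longrightarrow>
       (\<forall>x\<in>S. D (\<lambda>y. X y + X' y) Y x = D X Y x + D X' Y x)) \<and>
    (\<forall>X Y Y'. smooth_on S X \<longrightarrow> smooth_on S Y \<longrightarrow> smooth_on S Y' \<longrightarrow>
       (\<forall>x\<in>S. D X (\<lambda>y. Y y + Y' y) x = D X Y x + D X Y' x)) \<and>
    (\<forall>(f :: real ^ 'n \<Rightarrow> real) X Y. smooth_on S f \<longrightarrow> smooth_on S X \<longrightarrow> smooth_on S Y \<longrightarrow>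
       (\<forall>x\<in>S. D (\<lambda>y. f y *\<^sub>R X y) Y x = f x *\<^sub>R D X Y x)) \<and>
    (\<forall>(f :: real ^ 'n \<Rightarrow> real) X Y. smooth_on S f \<longrightarrow> smooth_on S X \<longrightarrow> smooth_on S Y \<longrightarrow>
       (\<forall>x\<in>S. D X (\<lambda>y. f y *\<^sub>R Y y) x = dir_deriv X f x *\<^sub>R Y x + f x *\<^sub>R D X Y x))"

definition levi_civita_on ::
    "(real ^ 'n::finite) set \<Rightarrow> (real ^ 'n \<Rightarrow> real ^ 'n ^ 'n) \<Rightarrow> 'n connection \<Rightarrow> bool"
  where "levi_civita_on S g D \<longleftrightarrow>
    affine_connection_on S D \<and>
    (\<forall>X Y. smooth_on S X \<longrightarrow> smooth_on S Y \<longrightarrow>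
       (\<forall>x\<in>S. D X Y x - D Y X x = lie_bracket X Y x)) \<and>
    (\<forall>X Y Z. smooth_on S X \<longrightarrow> smooth_on S Y \<longrightarrow> smooth_on S Z \<longrightarrow>
       (\<forall>x\<in>S. dir_deriv X (\<lambda>y. bilin (g y) (Y y) (Z y)) x =
                bilin (g x) (D X Y x) (Z x) + bilin (g x) (Y x) (D X Z x)))"

text \<open>The Levi-Civita connection of a metric on the manifold is given by its restrictions to the
  charts. Each of them is determined by the metric, so they agree on overlaps automatically.\<close>

definition levi_civita_connection ::
    "('a, 'n::finite) chart set \<Rightarrow> (('a, 'n) chart \<Rightarrow> real ^ 'n \<Rightarrow> real ^ 'n ^ 'n) \<Rightarrow>
     (('a, 'n) chart \<Rightarrow> 'n connection) \<Rightarrow> bool"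
  where "levi_civita_connection A g D \<longleftrightarrow> (\<forall>c\<in>A. levi_civita_on (chart_image c) (g c) (D c))"

definition curvature_op ::
    "'n::finite connection \<Rightarrow> (real ^ 'n \<Rightarrow> real ^ 'n) \<Rightarrow> (real ^ 'n \<Rightarrow> real ^ 'n) \<Rightarrow>
     (real ^ 'n \<Rightarrow> real ^ 'n) \<Rightarrow> real ^ 'n \<Rightarrow> real ^ 'n"
  where "curvature_op D X Y Z x = D X (D Y Z) x - D Y (D X Z) x - D (lie_bracket X Y) Z x"

text \<open>As for \<open>endo_at\<close>, tangent vectors are extended to vector fields with constant components.\<close>

definition curvature_at ::
    "'n::finite connection \<Rightarrow> real ^ 'n \<Rightarrow> real ^ 'n \<Rightarrow> real ^ 'n \<Rightarrow> real ^ 'n \<Rightarrow> real ^ 'n"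
  where "curvature_at D x u v w = curvature_op D (\<lambda>_. u) (\<lambda>_. v) (\<lambda>_. w) x"

definition curvature4 ::
    "(real ^ 'n::finite \<Rightarrow> real ^ 'n ^ 'n) \<Rightarrow> 'n connection \<Rightarrow> real ^ 'n \<Rightarrow>
     real ^ 'n \<Rightarrow> real ^ 'n \<Rightarrow> real ^ 'n \<Rightarrow> real ^ 'n \<Rightarrow> real"
  where "curvature4 g D x u v w z = bilin (g x) (curvature_at D x u v w) z"

definition ricci_operator ::
    "(real ^ 'n::finite \<Rightarrow> real ^ 'n ^ 'n) \<Rightarrow> 'n connection \<Rightarrow> real ^ 'n \<Rightarrow> real ^ 'n ^ 'n"
  where "ricci_operator g D x =
    (THE Q. \<forall>v w. bilin (g x) (Q *v v) w = trace (matrix (\<lambda>u. curvature_at D x u v w)))"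

definition flat_connection ::
    "('a, 'n::finite) chart set \<Rightarrow> (('a, 'n) chart \<Rightarrow> 'n connection) \<Rightarrow> bool"
  where "flat_connection A D \<longleftrightarrow>
    (\<forall>c\<in>A. \<forall>x\<in>chart_image c. \<forall>u v w. curvature_at (D c) x u v w = 0)"

definition paracontact_form ::
    "('a, 3) chart set \<Rightarrow> (('a, 3) chart \<Rightarrow> real ^ 3 \<Rightarrow> real ^ 3) \<Rightarrow> bool"
  where "paracontact_form A \<eta> \<longleftrightarrow> one_form A \<eta> \<and>
    (\<forall>c\<in>A. \<forall>x\<in>chart_image c. \<exists>X Y Z.
       smooth_on (chart_image c) X \<and> smooth_on (chart_image c) Y \<and> smooth_on (chart_image c) Z \<and>
       wedge_ext_deriv (\<eta> c) X Y Z x \<noteq> 0)"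

definition characteristic_field ::
    "('a, 3) chart set \<Rightarrow> (('a, 3) chart \<Rightarrow> real ^ 3 \<Rightarrow> real ^ 3) \<Rightarrow>
     (('a, 3) chart \<Rightarrow> real ^ 3 \<Rightarrow> real ^ 3) \<Rightarrow> bool"
  where "characteristic_field A \<eta> \<xi> \<longleftrightarrow> vector_field A \<xi> \<and>
    (\<forall>c\<in>A. \<forall>x\<in>chart_image c. \<eta> c x \<bullet> \<xi> c x = 1) \<and>
    (\<forall>c\<in>A. \<forall>X. smooth_on (chart_image c) X \<longrightarrow>
       (\<forall>x\<in>chart_image c. ext_deriv (\<eta> c) (\<xi> c) X x = 0))"

definition paracontact_metric_structure ::
    "('a, 3) chart set \<Rightarrow> (('a, 3) chart \<Rightarrow> real ^ 3 \<Rightarrow> real ^ 3 ^ 3) \<Rightarrow>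
     (('a, 3) chart \<Rightarrow> real ^ 3 \<Rightarrow> real ^ 3) \<Rightarrow> (('a, 3) chart \<Rightarrow> real ^ 3 \<Rightarrow> real ^ 3) \<Rightarrow>
     (('a, 3) chart \<Rightarrow> real ^ 3 \<Rightarrow> real ^ 3 ^ 3) \<Rightarrow> bool"
  where "paracontact_metric_structure A \<phi> \<xi> \<eta> g \<longleftrightarrow>
    paracontact_form A \<eta> \<and> characteristic_field A \<eta> \<xi> \<and>
    pseudo_riemannian_metric A g \<and> endomorphism_field A \<phi> \<and>
    (\<forall>c\<in>A. \<forall>X Y. smooth_on (chart_image c) X \<longrightarrow> smooth_on (chart_image c) Y \<longrightarrow>
       (\<forall>x\<in>chart_image c.
          ext_deriv (\<eta> c) X Y x = bilin (g c x) (X x) (\<phi> c x *v Y x) \<and>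
          \<eta> c x \<bullet> X x = bilin (g c x) (X x) (\<xi> c x) \<and>
          \<phi> c x *v (\<phi> c x *v X x) = X x - (\<eta> c x \<bullet> X x) *\<^sub>R \<xi> c x))"

text \<open>The arguments are the values at one point. \<open>xi_sectional_curvature\<close> is for \<open>u\<close> orthogonal
  to \<open>\<xi>\<close> with \<open>g(u,u) = \<plusminus>1\<close>; the factor \<open>bilin (g x) u u\<close> is that sign.\<close>

definition xi_sectional_curvature ::
    "(real ^ 'n::finite \<Rightarrow> real ^ 'n ^ 'n) \<Rightarrow> 'n connection \<Rightarrow> (real ^ 'n \<Rightarrow> real ^ 'n) \<Rightarrow>
     real ^ 'n \<Rightarrow> real ^ 'n \<Rightarrow> real"
  where "xi_sectional_curvature g D \<xi> x u =
    bilin (g x) u u * curvature4 g D x u (\<xi> x) (\<xi> x) u"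

definition phi_sectional_curvature ::
    "(real ^ 'n::finite \<Rightarrow> real ^ 'n ^ 'n) \<Rightarrow> 'n connection \<Rightarrow> (real ^ 'n \<Rightarrow> real ^ 'n ^ 'n) \<Rightarrow>
     real ^ 'n \<Rightarrow> real ^ 'n \<Rightarrow> real"
  where "phi_sectional_curvature g D \<phi> x u =
    - curvature4 g D x u (\<phi> x *v u) (\<phi> x *v u) u"

end

(* On the open set of a chart choose p, q with \<phi> p = p, \<phi> q = -q, g(p,q) = 1; then p and q are null and
   \<xi>, p, q is a frame. With a = g(\<nabla>_p p, \<xi>), e = g(\<nabla>_q q, \<xi>) one finds h p = a q, h q = -e p, so
   tr h^2 = -2ae, while Q \<phi> = \<phi> Q means Ric(p,p) = Ric(q,q) = Ric(p,\<xi>) = Ric(q,\<xi>) = 0. These four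
   equations determine \<xi>(a), \<xi>(e), q(a), p(e) in terms of the connection form of the frame, and the
   Jacobi identity for \<xi>, p, q then gives d(ae) = 0. Hence tr h^2 is locally constant. Where it is not 0,
   the connection form is d(log |a|)/2, hence closed, and the curvature of the plane spanned by p, q
   reduces to its quadratic terms: K(\<xi>,X) = -ae - 1 = -K(X,\<phi>X). Since
   tr h^2 does not depend on the chart, it is constant on M. The flat case is case (iii) with k = 0. *)

theory Submission
  imports Defs
begin

section \<open>Smooth maps\<close>

text \<open>An eigenframe of \<phi> is used rather than one of h: on the complement of \<xi> one has
  h^2 = -ae, so h may be diagonalisable, nilpotent or without real eigenvalues, whereas \<phi> has
  the eigenvalues 1 and -1 everywhere. One computation then covers both signs of tr h^2. The frame
  is only local, and it is unique only up to replacing p by f p and q by q / f, which multiplies a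
  by f^2 and divides e by f^2. Only the product ae can be compared between frames. Where a or e
  vanishes no division is possible; so p(a) and q(e) are found only after multiplication by e and a
  respectively, which is exactly what d(ae) needs. A second obstacle is formal: the axioms of
  \<open>D c\<close> concern fields that are smooth on the whole chart image, but p and q exist on a
  smaller open set. There \<open>D c\<close> is replaced by \<open>local_connection\<close>, the
  coordinate formula "derivative plus Christoffel term", which has the same curvature.\<close>

lemma C_k_on_cong:
  assumes "open S" "\<And>x. x \<in> S \<Longrightarrow> f x = g x" "C_k_on k f S"
  shows "C_k_on k g S"
  using assms(2,3)
proof (induction k arbitrary: f g)
  case 0
  then show ?case by (simp cong: continuous_on_cong)
next
  case (Suc k)
  have d: "f differentiable at x" if "x \<in> S" for x
    using Suc.prems that by simp
  have eq: "frechet_derivative f (at x) = frechet_derivative g (at x)" if "x \<in> S" for x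
    by (rule frechet_derivative_transform_within_open[OF d[OF that] \<open>open S\<close> that Suc.prems(1)])
  have "g differentiable at x" if "x \<in> S" for x
    using d[OF that] has_derivative_transform_within_open[OF _ \<open>open S\<close> that, of f _ UNIV g]
      Suc.prems(1) unfolding differentiable_def by blast
  moreover have "C_k_on k (\<lambda>x. frechet_derivative g (at x) v) S" for v
    by (rule Suc.IH[of "\<lambda>x. frechet_derivative f (at x) v"]) (use Suc.prems eq in auto)
  ultimately show ?case by simp
qed

lemma C_k_on_SucD: "C_k_on (Suc k) f S \<Longrightarrow> C_k_on k f S"
  by (induction k arbitrary: f)
    (auto intro!: continuous_at_imp_continuous_on differentiable_imp_continuous_within)

lemma C_k_on_subset: "C_k_on k f S \<Longrightarrow> T \<subseteq> S \<Longrightarrow> C_k_on k f T"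
  by (induction k arbitrary: f) (auto intro: continuous_on_subset)

lemma C_k_on_const: "C_k_on k (\<lambda>x. c) S"
  by (induction k arbitrary: c) auto

lemma C_k_on_bounded_linear:
  assumes "bounded_linear L" "open S" "C_k_on k f S"
  shows "C_k_on k (\<lambda>x. L (f x)) S"
  using assms(3)
proof (induction k arbitrary: f)
  case 0
  then show ?case using bounded_linear.continuous_on[OF assms(1)] by auto
next
  case (Suc k)
  have d: "((\<lambda>x. L (f x)) has_derivative (\<lambda>v. L (frechet_derivative f (at x) v))) (at x)"
    if "x \<in> S" for x
    using Suc.prems that
    by (intro bounded_linear.has_derivative[OF assms(1)]) (auto simp: frechet_derivative_works)
  have "C_k_on k (\<lambda>x. frechet_derivative (\<lambda>x. L (f x)) (at x) v) S" for v
    by (rule C_k_on_cong[OF assms(2) _ Suc.IH[of "\<lambda>x. frechet_derivative f (at x) v"]])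
      (use Suc.prems frechet_derivative_at[OF d] in \<open>auto simp: fun_eq_iff\<close>)
  with d show ?case by (auto simp: differentiable_def)
qed

lemma C_k_on_add:
  assumes "open S" "C_k_on k f S" "C_k_on k g S"
  shows "C_k_on k (\<lambda>x. f x + g x) S"
  using assms(2,3)
proof (induction k arbitrary: f g)
  case 0
  then show ?case by (auto intro: continuous_intros)
next
  case (Suc k)
  have d: "((\<lambda>x. f x + g x) has_derivative
      (\<lambda>v. frechet_derivative f (at x) v + frechet_derivative g (at x) v)) (at x)"
    if "x \<in> S" for x
    using Suc.prems that by (intro has_derivative_add) (auto simp: frechet_derivative_works)
  have "C_k_on k (\<lambda>x. frechet_derivative (\<lambda>x. f x + g x) (at x) v) S" for v
    by (rule C_k_on_cong[OF assms(1) _ Suc.IH[of "\<lambda>x. frechet_derivative f (at x) v"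
            "\<lambda>x. frechet_derivative g (at x) v"]])
      (use Suc.prems frechet_derivative_at[OF d] in \<open>auto simp: fun_eq_iff\<close>)
  with d show ?case by (auto simp: differentiable_def)
qed

text \<open>The product rule differentiates one factor and keeps the other, so the induction
  generalises over both; \<open>C_k_on_SucD\<close> lowers the factor that is kept to order
  \<open>k\<close>.\<close>

lemma C_k_on_bounded_bilinear:
  assumes B: "bounded_bilinear B" and "open S" "C_k_on k f S" "C_k_on k g S"
  shows "C_k_on k (\<lambda>x. B (f x) (g x)) S"
  using assms(3,4)
proof (induction k arbitrary: f g)
  case 0
  then show ?case using bounded_bilinear.continuous_on[OF B] by auto
next
  case (Suc k)
  have d: "((\<lambda>x. B (f x) (g x)) has_derivative
      (\<lambda>v. B (f x) (frechet_derivative g (at x) v) + B (frechet_derivative f (at x) v) (g x))) (at x)"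
    if "x \<in> S" for x
    using Suc.prems that
    by (intro bounded_bilinear.FDERIV[OF B]) (auto simp: frechet_derivative_works)
  have "C_k_on k f S" "C_k_on k g S"
    using Suc.prems C_k_on_SucD by blast+
  then have "C_k_on k (\<lambda>x. frechet_derivative (\<lambda>x. B (f x) (g x)) (at x) v) S" for v
    by (intro C_k_on_cong[OF assms(2) _ C_k_on_add[OF assms(2)
          Suc.IH[of f "\<lambda>x. frechet_derivative g (at x) v"]
          Suc.IH[of "\<lambda>x. frechet_derivative f (at x) v" g]]])
      (use Suc.prems frechet_derivative_at[OF d] in \<open>auto simp: fun_eq_iff\<close>)
  with d show ?case by (auto simp: differentiable_def)
qed

text \<open>The derivative of 1/f is a product of 1/f, f' and 1/f. The induction hypothesis for the
  same \<open>f\<close> supplies 1/f at order \<open>k\<close>, so no generalisation over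
  \<open>f\<close> is needed.\<close>

lemma C_k_on_inverse:
  fixes f :: "'a::real_normed_vector \<Rightarrow> real"
  assumes "open S" "C_k_on k f S" "\<And>x. x \<in> S \<Longrightarrow> f x \<noteq> 0"
  shows "C_k_on k (\<lambda>x. inverse (f x)) S"
  using assms(2)
proof (induction k)
  case 0
  then show ?case using assms(3) by (auto intro: continuous_intros)
next
  case (Suc k)
  have d: "((\<lambda>x. inverse (f x)) has_derivative
      (\<lambda>v. - (inverse (f x) * frechet_derivative f (at x) v * inverse (f x)))) (at x)"
    if "x \<in> S" for x
    using Suc.prems that assms(3)
    by (intro Deriv.has_derivative_inverse) (auto simp: frechet_derivative_works)
  have I: "C_k_on k (\<lambda>x. inverse (f x)) S"
    using Suc.prems C_k_on_SucD Suc.IH by blast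
  have "C_k_on k (\<lambda>x. - (inverse (f x) * frechet_derivative f (at x) v * inverse (f x))) S" for v
    using Suc.prems
    by (intro C_k_on_bounded_linear[OF bounded_linear_minus[OF bounded_linear_ident]]
        C_k_on_bounded_bilinear[OF bounded_bilinear_mult] assms(1) I) auto
  then have "C_k_on k (\<lambda>x. frechet_derivative (\<lambda>x. inverse (f x)) (at x) v) S" for v
    by (rule C_k_on_cong[OF assms(1), rotated])
      (use frechet_derivative_at[OF d] in \<open>auto simp: fun_eq_iff\<close>)
  with d show ?case by (auto simp: differentiable_def)
qed

lemma smooth_on_cong:
  "open S \<Longrightarrow> (\<And>x. x \<in> S \<Longrightarrow> f x = g x) \<Longrightarrow> smooth_on S f \<Longrightarrow> smooth_on S g"
  unfolding smooth_on_def using C_k_on_cong by blast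

lemma smooth_on_subset: "smooth_on S f \<Longrightarrow> T \<subseteq> S \<Longrightarrow> smooth_on T f"
  unfolding smooth_on_def using C_k_on_subset by blast

lemma smooth_on_const [intro, simp]: "smooth_on S (\<lambda>x. c)"
  unfolding smooth_on_def using C_k_on_const by blast

lemma smooth_on_bounded_linear:
  "bounded_linear L \<Longrightarrow> open S \<Longrightarrow> smooth_on S f \<Longrightarrow> smooth_on S (\<lambda>x. L (f x))"
  unfolding smooth_on_def using C_k_on_bounded_linear by blast

lemma smooth_on_bounded_bilinear:
  "bounded_bilinear B \<Longrightarrow> open S \<Longrightarrow> smooth_on S f \<Longrightarrow> smooth_on S g \<Longrightarrow> smooth_on S (\<lambda>x. B (f x) (g x))"
  unfolding smooth_on_def using C_k_on_bounded_bilinear by blast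

lemma smooth_on_add:
  "open S \<Longrightarrow> smooth_on S f \<Longrightarrow> smooth_on S g \<Longrightarrow> smooth_on S (\<lambda>x. f x + g x)"
  unfolding smooth_on_def using C_k_on_add by blast

lemma smooth_on_inverse:
  fixes f :: "'a::real_normed_vector \<Rightarrow> real"
  shows "open S \<Longrightarrow> smooth_on S f \<Longrightarrow> (\<And>x. x \<in> S \<Longrightarrow> f x \<noteq> 0) \<Longrightarrow> smooth_on S (\<lambda>x. inverse (f x))"
  unfolding smooth_on_def using C_k_on_inverse by blast

lemmas smooth_on_scaleR = smooth_on_bounded_bilinear[OF bounded_bilinear_scaleR]
lemmas smooth_on_inner = smooth_on_bounded_bilinear[OF bounded_bilinear_inner]
lemmas smooth_on_minus = smooth_on_bounded_linear[OF bounded_linear_minus[OF bounded_linear_ident]]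

lemma smooth_on_diff:
  "open S \<Longrightarrow> smooth_on S f \<Longrightarrow> smooth_on S g \<Longrightarrow> smooth_on S (\<lambda>x. f x - g x)"
  using smooth_on_add[of S f "\<lambda>x. - g x"] smooth_on_minus[of S g] by simp

lemma smooth_on_sum:
  "open S \<Longrightarrow> (\<And>i. i \<in> I \<Longrightarrow> smooth_on S (f i)) \<Longrightarrow> smooth_on S (\<lambda>x. \<Sum>i\<in>I. f i x)"
  by (induction I rule: infinite_finite_induct) (auto intro: smooth_on_add)

lemma bounded_bilinear_matrix_vector_mult:
  "bounded_bilinear ((*v) :: real ^ 'm ^ 'n \<Rightarrow> real ^ 'm \<Rightarrow> real ^ 'n)"
proof -
  have "bilinear ((*v) :: real ^ 'm ^ 'n \<Rightarrow> real ^ 'm \<Rightarrow> real ^ 'n)"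
    by (auto simp: bilinear_def algebra_simps scaleR_matrix_vector_assoc intro!: linearI)
  then show ?thesis by (simp add: bilinear_conv_bounded_bilinear)
qed

lemmas smooth_on_matrix_vector_mult = smooth_on_bounded_bilinear[OF bounded_bilinear_matrix_vector_mult]

lemma smooth_on_differentiable: "smooth_on S f \<Longrightarrow> x \<in> S \<Longrightarrow> f differentiable at x"
  unfolding smooth_on_def by (metis C_k_on.simps(2))

lemma smooth_on_has_derivative:
  "smooth_on S f \<Longrightarrow> x \<in> S \<Longrightarrow> (f has_derivative frechet_derivative f (at x)) (at x)"
  using smooth_on_differentiable frechet_derivative_works by blast

lemma smooth_on_continuous_on: "smooth_on S f \<Longrightarrow> continuous_on S f"
  unfolding smooth_on_def by (metis C_k_on.simps(1))

lemma smooth_on_frechet_derivative: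
  "smooth_on S f \<Longrightarrow> smooth_on S (\<lambda>x. frechet_derivative f (at x) v)"
  unfolding smooth_on_def by (metis C_k_on.simps(2))

lemma smooth_on_bilin:
  fixes g :: "'a::real_normed_vector \<Rightarrow> real ^ 'n ^ 'n"
  assumes "open S" "smooth_on S g" "smooth_on S Y" "smooth_on S Z"
  shows "smooth_on S (\<lambda>x. bilin (g x) (Y x) (Z x))"
  unfolding bilin_def by (intro smooth_on_inner smooth_on_matrix_vector_mult assms)

section \<open>Symmetry of second derivatives\<close>

text \<open>The mean value theorem is applied twice: along \<open>u\<close> to the difference of
  \<open>f\<close> across the edge \<open>t v\<close>, then along \<open>v\<close> to the derivative
  in direction \<open>u\<close>. The left side is symmetric in \<open>u\<close> and
  \<open>v\<close>, the right side is not visibly so; this is the source of symmetry.\<close>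

lemma second_difference:
  fixes f :: "'a::real_normed_vector \<Rightarrow> real"
  assumes f: "smooth_on S f" "ball x r \<subseteq> S" and t: "t > 0" "t * (norm u + norm v) < r"
  shows "\<exists>y\<in>ball x r. f (x + t *\<^sub>R u + t *\<^sub>R v) - f (x + t *\<^sub>R u) - f (x + t *\<^sub>R v) + f x =
    t^2 * frechet_derivative (\<lambda>y. frechet_derivative f (at y) u) (at y) v"
proof -
  let ?f' = "\<lambda>y. frechet_derivative f (at y)"
  let ?f'' = "\<lambda>y. frechet_derivative (\<lambda>y. ?f' y u) (at y) v"
  have inb: "x + a *\<^sub>R u + b *\<^sub>R v \<in> ball x r" if "0 \<le> a" "a \<le> t" "0 \<le> b" "b \<le> t" for a b
  proof -
    have "norm (a *\<^sub>R u + b *\<^sub>R v) \<le> a * norm u + b * norm v"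
      using norm_triangle_ineq[of "a *\<^sub>R u" "b *\<^sub>R v"] that by simp
    also have "\<dots> \<le> t * norm u + t * norm v"
      using that by (intro add_mono mult_right_mono) auto
    also have "\<dots> < r" using t by (simp add: algebra_simps)
    finally show ?thesis
      by (metis add.assoc add_diff_cancel_left' dist_commute dist_norm mem_ball)
  qed
  have inS: "x + a *\<^sub>R u + b *\<^sub>R v \<in> S" if "0 \<le> a" "a \<le> t" "0 \<le> b" "b \<le> t" for a b
    using inb[OF that] f(2) by blast
  define G where "G s = f (x + s *\<^sub>R u + t *\<^sub>R v) - f (x + s *\<^sub>R u)" for s
  have hd: "((\<lambda>s. f (x + s *\<^sub>R u + b *\<^sub>R v)) has_real_derivative ?f' (x + s *\<^sub>R u + b *\<^sub>R v) u) (at s)"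
    if "0 \<le> s" "s \<le> t" "0 \<le> b" "b \<le> t" for s b
  proof -
    have 1: "(f has_derivative ?f' (x + s *\<^sub>R u + b *\<^sub>R v)) (at (x + s *\<^sub>R u + b *\<^sub>R v))"
      using smooth_on_has_derivative[OF f(1) inS] that by auto
    have 2: "((\<lambda>s. x + s *\<^sub>R u + b *\<^sub>R v) has_derivative (\<lambda>h. h *\<^sub>R u)) (at s)"
      by (auto intro!: derivative_eq_intros)
    have "((\<lambda>s. f (x + s *\<^sub>R u + b *\<^sub>R v)) has_derivative (\<lambda>h. ?f' (x + s *\<^sub>R u + b *\<^sub>R v) (h *\<^sub>R u))) (at s)"
      using diff_chain_at[OF 2 1] by (simp add: o_def)
    moreover have "?f' (x + s *\<^sub>R u + b *\<^sub>R v) (h *\<^sub>R u) = ?f' (x + s *\<^sub>R u + b *\<^sub>R v) u * h" for h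
      using has_derivative_bounded_linear[OF 1] by (simp add: linear_cmul bounded_linear.linear)
    ultimately show ?thesis by (simp add: has_field_derivative_def)
  qed
  have "(G has_real_derivative (?f' (x + s *\<^sub>R u + t *\<^sub>R v) u - ?f' (x + s *\<^sub>R u) u)) (at s)"
    if "0 \<le> s" "s \<le> t" for s
    unfolding G_def using DERIV_diff[OF hd[OF that, of t] hd[OF that, of 0]] t by simp
  from MVT2[OF \<open>t > 0\<close> this] obtain s where s: "0 < s" "s < t"
    "G t - G 0 = t * (?f' (x + s *\<^sub>R u + t *\<^sub>R v) u - ?f' (x + s *\<^sub>R u) u)"
    by auto
  define H where "H b = ?f' (x + s *\<^sub>R u + b *\<^sub>R v) u" for b
  have "(H has_real_derivative ?f'' (x + s *\<^sub>R u + b *\<^sub>R v)) (at b)" if "0 \<le> b" "b \<le> t" for b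
  proof -
    have 1: "((\<lambda>y. ?f' y u) has_derivative frechet_derivative (\<lambda>y. ?f' y u) (at (x + s *\<^sub>R u + b *\<^sub>R v)))
        (at (x + s *\<^sub>R u + b *\<^sub>R v))"
      using smooth_on_has_derivative[OF smooth_on_frechet_derivative[OF f(1)] inS] that s by auto
    have 2: "((\<lambda>b. x + s *\<^sub>R u + b *\<^sub>R v) has_derivative (\<lambda>h. h *\<^sub>R v)) (at b)"
      by (auto intro!: derivative_eq_intros)
    have "(H has_derivative (\<lambda>h. frechet_derivative (\<lambda>y. ?f' y u) (at (x + s *\<^sub>R u + b *\<^sub>R v)) (h *\<^sub>R v))) (at b)"
      using diff_chain_at[OF 2 1] by (simp add: o_def H_def[abs_def])
    moreover have "frechet_derivative (\<lambda>y. ?f' y u) (at (x + s *\<^sub>R u + b *\<^sub>R v)) (h *\<^sub>R v) = ?f'' (x + s *\<^sub>R u + b *\<^sub>R v) * h" for h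
      using has_derivative_bounded_linear[OF 1] by (simp add: linear_cmul bounded_linear.linear)
    ultimately show ?thesis by (simp add: has_field_derivative_def)
  qed
  from MVT2[OF \<open>t > 0\<close> this] obtain b where b: "0 < b" "b < t"
    "H t - H 0 = t * ?f'' (x + s *\<^sub>R u + b *\<^sub>R v)"
    by auto
  show ?thesis
    using s b inb[of s b] by (intro bexI[of _ "x + s *\<^sub>R u + b *\<^sub>R v"])
      (auto simp: G_def H_def power2_eq_square)
qed

lemma second_derivative_symmetric_real:
  fixes f :: "'a::real_normed_vector \<Rightarrow> real"
  assumes "open S" "smooth_on S f" "x \<in> S"
  shows "frechet_derivative (\<lambda>y. frechet_derivative f (at y) u) (at x) v =
    frechet_derivative (\<lambda>y. frechet_derivative f (at y) v) (at x) u" (is "?A x = ?B x")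
proof (rule ccontr)
  assume ne: "?A x \<noteq> ?B x"
  \<comment> \<open>The two derivatives take a common value, one at \<open>y\<close> and the other
    at \<open>z\<close>. If both are within half of the gap of their values at \<open>x\<close>, the
    gap is smaller than itself.\<close>
  define e where "e = \<bar>?A x - ?B x\<bar> / 2"
  have e: "e > 0" using ne by (simp add: e_def)
  have "isCont ?A x" "isCont ?B x"
    using assms by (auto intro!: continuous_on_interior smooth_on_continuous_on
        smooth_on_frechet_derivative simp: interior_open)
  then obtain r1 r2 where r: "r1 > 0" "r2 > 0" "\<And>y. dist y x < r1 \<Longrightarrow> dist (?A y) (?A x) < e"
    "\<And>y. dist y x < r2 \<Longrightarrow> dist (?B y) (?B x) < e"
    using e unfolding continuous_at_eps_delta by metis
  obtain r3 where r3: "r3 > 0" "ball x r3 \<subseteq> S"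
    using assms open_contains_ball by blast
  define r where "r = min r1 (min r2 r3)"
  have r0: "r > 0" and sub: "ball x r \<subseteq> S"
    using r r3 by (auto simp: r_def)
  \<comment> \<open>The summand 1 keeps the denominator positive when \<open>u\<close> and
    \<open>v\<close> are 0, and makes the bound by \<open>r\<close> strict.\<close>
  define t where "t = r / (norm u + norm v + 1)"
  have n: "norm u + norm v + 1 > 0"
    by (smt (verit) norm_ge_zero)
  have t: "t > 0" using r0 n by (simp add: t_def)
  have "t * (norm u + norm v) < t * (norm u + norm v + 1)" using t by simp
  also have "\<dots> = r" using n by (simp add: t_def)
  finally have t': "t * (norm u + norm v) < r" "t * (norm v + norm u) < r" by (auto simp: add.commute)
  obtain y z where y: "y \<in> ball x r" "z \<in> ball x r"
    "f (x + t *\<^sub>R u + t *\<^sub>R v) - f (x + t *\<^sub>R u) - f (x + t *\<^sub>R v) + f x = t^2 * ?A y"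
    "f (x + t *\<^sub>R v + t *\<^sub>R u) - f (x + t *\<^sub>R v) - f (x + t *\<^sub>R u) + f x = t^2 * ?B z"
    using second_difference[OF assms(2) sub t t'(1)] second_difference[OF assms(2) sub t t'(2)] by blast
  have "t^2 * ?A y = t^2 * ?B z"
    using y(3,4) by (simp add: algebra_simps)
  then have "?A y = ?B z" using t by simp
  moreover have "dist (?A y) (?A x) < e" "dist (?B z) (?B x) < e"
    using r(3,4)[of y] r(3,4)[of z] y(1,2) by (simp_all add: r_def dist_commute)
  ultimately show False unfolding e_def dist_real_def by (smt (verit) field_sum_of_halves)
qed

lemma frechet_derivative_bounded_linear:
  assumes "bounded_linear L" "f differentiable at x"
  shows "frechet_derivative (\<lambda>y. L (f y)) (at x) v = L (frechet_derivative f (at x) v)"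
  by (metis assms bounded_linear.has_derivative frechet_derivative_at frechet_derivative_works)

lemma second_derivative_symmetric:
  fixes f :: "'a::real_normed_vector \<Rightarrow> 'b::euclidean_space"
  assumes "open S" "smooth_on S f" "x \<in> S"
  shows "frechet_derivative (\<lambda>y. frechet_derivative f (at y) u) (at x) v =
    frechet_derivative (\<lambda>y. frechet_derivative f (at y) v) (at x) u"
proof (rule euclidean_eqI)
  fix i :: 'b
  have L: "bounded_linear (\<lambda>z::'b. z \<bullet> i)" by (rule bounded_linear_inner_left)
  have S: "smooth_on S (\<lambda>y. f y \<bullet> i)"
    by (rule smooth_on_bounded_linear[OF L assms(1,2)])
  have *: "frechet_derivative (\<lambda>y. frechet_derivative (\<lambda>y. f y \<bullet> i) (at y) u) (at x) v =
    frechet_derivative (\<lambda>y. frechet_derivative f (at y) u) (at x) v \<bullet> i" for u v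
  proof -
    have "frechet_derivative (\<lambda>y. frechet_derivative (\<lambda>y. f y \<bullet> i) (at y) u) (at x) =
        frechet_derivative (\<lambda>y. frechet_derivative f (at y) u \<bullet> i) (at x)"
      by (rule frechet_derivative_transform_within_open[OF _ assms(1,3)])
        (use smooth_on_differentiable[OF smooth_on_frechet_derivative[OF S] assms(3)]
           frechet_derivative_bounded_linear[OF L smooth_on_differentiable[OF assms(2)]] in auto)
    then show ?thesis
      using frechet_derivative_bounded_linear[OF L
          smooth_on_differentiable[OF smooth_on_frechet_derivative[OF assms(2)] assms(3)]]
      by (simp add: fun_eq_iff)
  qed
  show "frechet_derivative (\<lambda>y. frechet_derivative f (at y) u) (at x) v \<bullet> i =
    frechet_derivative (\<lambda>y. frechet_derivative f (at y) v) (at x) u \<bullet> i"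
    using second_derivative_symmetric_real[OF assms(1) S assms(3), of u v] by (simp add: *)
qed

section \<open>Directional derivatives and affine connections\<close>

lemma dir_deriv_cong:
  assumes "open S" "x \<in> S" "f differentiable at x" "\<And>y. y \<in> S \<Longrightarrow> f y = g y"
  shows "dir_deriv X f x = dir_deriv X g x"
  using frechet_derivative_transform_within_open[OF assms(3,1,2,4)] by (simp add: dir_deriv_def)

lemma dir_deriv_const [simp]: "dir_deriv X (\<lambda>y. c) = (\<lambda>_. 0)"
  by (simp add: dir_deriv_def fun_eq_iff)

lemma dir_deriv_eq: "(f has_derivative f') (at x) \<Longrightarrow> dir_deriv X f x = f' (X x)"
  using frechet_derivative_at[of f f' x] by (simp add: dir_deriv_def)

lemma dir_deriv_add:
  "f differentiable at x \<Longrightarrow> g differentiable at x \<Longrightarrow>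
    dir_deriv X (\<lambda>y. f y + g y) x = dir_deriv X f x + dir_deriv X g x"
  unfolding dir_deriv_def
  by (subst frechet_derivative_at[OF has_derivative_add, symmetric]) (auto simp: frechet_derivative_works)

lemma dir_deriv_diff:
  "f differentiable at x \<Longrightarrow> g differentiable at x \<Longrightarrow>
    dir_deriv X (\<lambda>y. f y - g y) x = dir_deriv X f x - dir_deriv X g x"
  unfolding dir_deriv_def
  by (subst frechet_derivative_at[OF has_derivative_diff, symmetric]) (auto simp: frechet_derivative_works)

lemma dir_deriv_sum:
  "(\<And>i. i \<in> I \<Longrightarrow> f i differentiable at x) \<Longrightarrow>
    dir_deriv X (\<lambda>y. \<Sum>i\<in>I. f i y) x = (\<Sum>i\<in>I. dir_deriv X (f i) x)"
  unfolding dir_deriv_def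
  by (subst frechet_derivative_at[OF has_derivative_sum, symmetric])
    (auto simp: frechet_derivative_works)

lemma dir_deriv_bounded_linear:
  "bounded_linear L \<Longrightarrow> f differentiable at x \<Longrightarrow> dir_deriv X (\<lambda>y. L (f y)) x = L (dir_deriv X f x)"
  by (simp add: dir_deriv_def frechet_derivative_bounded_linear)

lemma dir_deriv_bounded_bilinear:
  "bounded_bilinear B \<Longrightarrow> f differentiable at x \<Longrightarrow> g differentiable at x \<Longrightarrow>
    dir_deriv X (\<lambda>y. B (f y) (g y)) x = B (f x) (dir_deriv X g x) + B (dir_deriv X f x) (g x)"
  unfolding dir_deriv_def
  by (subst frechet_derivative_at[OF bounded_bilinear.FDERIV, symmetric])
    (auto simp: frechet_derivative_works)

lemmas dir_deriv_scaleR = dir_deriv_bounded_bilinear[OF bounded_bilinear_scaleR]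
lemmas dir_deriv_mult = dir_deriv_bounded_bilinear[OF bounded_bilinear_mult]
lemmas dir_deriv_inner = dir_deriv_bounded_bilinear[OF bounded_bilinear_inner]
lemmas dir_deriv_matrix_vector_mult =
  dir_deriv_bounded_bilinear[OF bounded_bilinear_matrix_vector_mult]
lemmas dir_deriv_minus = dir_deriv_bounded_linear[OF bounded_linear_minus[OF bounded_linear_ident]]

lemma dir_deriv_add_left:
  "f differentiable at x \<Longrightarrow> dir_deriv (\<lambda>y. X y + Y y) f x = dir_deriv X f x + dir_deriv Y f x"
  by (simp add: dir_deriv_def linear_frechet_derivative linear_add)

lemma dir_deriv_diff_left:
  "f differentiable at x \<Longrightarrow> dir_deriv (\<lambda>y. X y - Y y) f x = dir_deriv X f x - dir_deriv Y f x"
  by (simp add: dir_deriv_def linear_frechet_derivative linear_diff)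

lemma dir_deriv_scaleR_left:
  "f differentiable at x \<Longrightarrow> dir_deriv (\<lambda>y. h y *\<^sub>R X y) f x = h x *\<^sub>R dir_deriv X f x"
  by (simp add: dir_deriv_def linear_frechet_derivative linear_cmul)

lemma vec_axis_expansion: "v = (\<Sum>i\<in>UNIV. v $ i *\<^sub>R axis i (1::real))"
  using basis_expansion[of v] by (simp add: scalar_mult_eq_scaleR)

lemma linear_axis_expansion:
  "linear L \<Longrightarrow> L v = (\<Sum>i\<in>UNIV. v $ i *\<^sub>R L (axis i (1::real)))"
  by (subst vec_axis_expansion[of v]) (simp add: linear_sum linear_cmul)

lemma smooth_on_vec_nth:
  "open S \<Longrightarrow> smooth_on S X \<Longrightarrow> smooth_on S (\<lambda>x. X x $ i)"
  by (rule smooth_on_bounded_linear[OF bounded_linear_vec_nth])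

text \<open>Used for linear maps that are not given as matrices: derivatives of maps, Christoffel
  terms, and bilinear forms with one slot fixed. Their smoothness is known on constant vectors only,
  and expansion of \<open>Y\<close> in the standard basis extends it.\<close>

lemma smooth_on_linear_family:
  fixes T :: "'a::real_normed_vector \<Rightarrow> real ^ 'n \<Rightarrow> 'b::real_normed_vector"
  assumes "open S" "smooth_on S Y" "\<And>y. y \<in> S \<Longrightarrow> linear (T y)" "\<And>v. smooth_on S (\<lambda>y. T y v)"
  shows "smooth_on S (\<lambda>y. T y (Y y))"
proof (rule smooth_on_cong[OF assms(1)])
  show "smooth_on S (\<lambda>y. \<Sum>i\<in>UNIV. Y y $ i *\<^sub>R T y (axis i 1))"
    by (intro smooth_on_sum smooth_on_scaleR smooth_on_vec_nth assms)
qed (metis assms(3) linear_axis_expansion)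

text \<open>The product rule for such a family. In the first term the argument is frozen at
  \<open>Y x\<close>, so that only the dependence of \<open>T\<close> on the point is
  differentiated.\<close>

lemma dir_deriv_linear_family:
  fixes T :: "real ^ 'n \<Rightarrow> real ^ 'n \<Rightarrow> 'b::real_normed_vector"
  assumes S: "open S" "x \<in> S" and Y: "smooth_on S Y"
    and T: "\<And>y. y \<in> S \<Longrightarrow> linear (T y)" "\<And>v. smooth_on S (\<lambda>y. T y v)"
  shows "dir_deriv X (\<lambda>y. T y (Y y)) x = dir_deriv X (\<lambda>y. T y (Y x)) x + T x (dir_deriv X Y x)"
proof -
  have dT: "(\<lambda>y. T y v) differentiable at x" for v
    using smooth_on_differentiable[OF T(2) S(2)] .
  have dY: "Y differentiable at x" "(\<lambda>y. Y y $ i) differentiable at x" for i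
    using smooth_on_differentiable[OF Y S(2)]
      smooth_on_differentiable[OF smooth_on_vec_nth[OF S(1) Y] S(2)] .
  have ax: "T y v = (\<Sum>i\<in>UNIV. v $ i *\<^sub>R T y (axis i 1))" if "y \<in> S" for y v
    by (rule linear_axis_expansion[OF T(1)[OF that]])
  have "dir_deriv X (\<lambda>y. T y (Y y)) x = dir_deriv X (\<lambda>y. \<Sum>i\<in>UNIV. Y y $ i *\<^sub>R T y (axis i 1)) x"
    by (rule dir_deriv_cong[OF S smooth_on_differentiable[OF smooth_on_linear_family[OF S(1) Y T] S(2)]])
      (auto intro: ax)
  also have "\<dots> = (\<Sum>i\<in>UNIV. dir_deriv X (\<lambda>y. Y y $ i *\<^sub>R T y (axis i 1)) x)"
    by (intro dir_deriv_sum differentiable_scaleR dT dY)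
  also have "\<dots> = (\<Sum>i\<in>UNIV. Y x $ i *\<^sub>R dir_deriv X (\<lambda>y. T y (axis i 1)) x
      + dir_deriv X Y x $ i *\<^sub>R T x (axis i 1))"
    by (simp add: dir_deriv_scaleR dT dY dir_deriv_bounded_linear[OF bounded_linear_vec_nth])
  also have "\<dots> = (\<Sum>i\<in>UNIV. Y x $ i *\<^sub>R dir_deriv X (\<lambda>y. T y (axis i 1)) x) + T x (dir_deriv X Y x)"
    by (simp add: sum.distrib flip: linear_axis_expansion[OF T(1)[OF S(2)]])
  also have "(\<Sum>i\<in>UNIV. Y x $ i *\<^sub>R dir_deriv X (\<lambda>y. T y (axis i 1)) x) =
      (\<Sum>i\<in>UNIV. dir_deriv X (\<lambda>y. Y x $ i *\<^sub>R T y (axis i 1)) x)"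
    by (simp add: dir_deriv_bounded_linear[OF bounded_linear_scaleR_right] dT)
  also have "\<dots> = dir_deriv X (\<lambda>y. \<Sum>i\<in>UNIV. Y x $ i *\<^sub>R T y (axis i 1)) x"
    by (rule dir_deriv_sum[symmetric]) (intro differentiable_scaleR dT differentiable_const)
  also have "\<dots> = dir_deriv X (\<lambda>y. T y (Y x)) x"
    by (rule dir_deriv_cong[OF S dT, symmetric]) (simp flip: ax)
  finally show ?thesis .
qed

lemma smooth_on_dir_deriv:
  "open S \<Longrightarrow> smooth_on S X \<Longrightarrow> smooth_on S f \<Longrightarrow> smooth_on S (dir_deriv X f)"
  unfolding dir_deriv_def[abs_def]
  by (rule smooth_on_linear_family)
    (auto intro: smooth_on_frechet_derivative linear_frechet_derivative smooth_on_differentiable)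

lemma smooth_on_lie_bracket:
  "open S \<Longrightarrow> smooth_on S X \<Longrightarrow> smooth_on S Y \<Longrightarrow> smooth_on S (lie_bracket X Y)"
  unfolding lie_bracket_def[abs_def] by (intro smooth_on_diff smooth_on_dir_deriv)

text \<open>The second-order parts cancel by symmetry of the second derivative; what is left
  differentiates \<open>f\<close> along the derivatives of the two fields, which make up the
  bracket.\<close>

lemma dir_deriv_commutator:
  fixes f :: "real ^ 'n \<Rightarrow> 'b::euclidean_space"
  assumes S: "open S" "x \<in> S" and X: "smooth_on S X" and Y: "smooth_on S Y" and f: "smooth_on S f"
  shows "dir_deriv X (dir_deriv Y f) x - dir_deriv Y (dir_deriv X f) x =
    dir_deriv (lie_bracket X Y) f x"
proof -
  have *: "dir_deriv V (dir_deriv W f) x =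
      frechet_derivative (\<lambda>y. frechet_derivative f (at y) (W x)) (at x) (V x)
      + frechet_derivative f (at x) (dir_deriv V W x)" if "smooth_on S W" for V W
    using dir_deriv_linear_family[OF S that, of "\<lambda>y. frechet_derivative f (at y)" V]
      linear_frechet_derivative[OF smooth_on_differentiable[OF f]] smooth_on_frechet_derivative[OF f]
    by (simp add: dir_deriv_def[abs_def])
  show ?thesis
    using second_derivative_symmetric[OF S(1) f S(2), of "X x" "Y x"]
    by (simp add: * X Y lie_bracket_def dir_deriv_def[of "lie_bracket X Y"] linear_diff
        linear_frechet_derivative smooth_on_differentiable[OF f S(2)])
qed

text \<open>A vector field in coordinates is itself a vector-valued function, so the commutator
  formula applies to each of the three fields, differentiated along the other two.\<close>

lemma lie_bracket_jacobi:
  assumes S: "open S" "x \<in> S" and X: "smooth_on S X" and Y: "smooth_on S Y" and Z: "smooth_on S Z"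
  shows "lie_bracket X (lie_bracket Y Z) x =
    lie_bracket (lie_bracket X Y) Z x + lie_bracket Y (lie_bracket X Z) x"
proof -
  have *: "dir_deriv U (lie_bracket V W) x = dir_deriv U (dir_deriv V W) x - dir_deriv U (dir_deriv W V) x"
    if "smooth_on S V" "smooth_on S W" for U V W
    unfolding lie_bracket_def[abs_def]
    by (intro dir_deriv_diff smooth_on_differentiable[OF smooth_on_dir_deriv[OF S(1)] S(2)] that)
  show ?thesis
    using dir_deriv_commutator[OF S Y Z X] dir_deriv_commutator[OF S X Y Z]
      dir_deriv_commutator[OF S X Z Y]
    by (simp add: lie_bracket_def[of X "lie_bracket Y Z"] lie_bracket_def[of "lie_bracket X Y" Z]
        lie_bracket_def[of Y "lie_bracket X Z"] * X Y Z algebra_simps)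
qed

lemma lie_bracket_antisym: "lie_bracket X Y x = - lie_bracket Y X x"
  by (simp add: lie_bracket_def)

lemma lie_bracket_self [simp]: "lie_bracket X X x = 0"
  by (simp add: lie_bracket_def)

lemma lie_bracket_const [simp]: "lie_bracket (\<lambda>_. u) (\<lambda>_. v) = (\<lambda>_. 0)"
  by (simp add: lie_bracket_def fun_eq_iff)

lemma lie_bracket_add_right:
  "X differentiable at x \<Longrightarrow> Y differentiable at x \<Longrightarrow> Z differentiable at x \<Longrightarrow>
    lie_bracket X (\<lambda>y. Y y + Z y) x = lie_bracket X Y x + lie_bracket X Z x"
  by (simp add: lie_bracket_def dir_deriv_add dir_deriv_add_left)

lemma lie_bracket_diff_right:
  "X differentiable at x \<Longrightarrow> Y differentiable at x \<Longrightarrow> Z differentiable at x \<Longrightarrow>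
    lie_bracket X (\<lambda>y. Y y - Z y) x = lie_bracket X Y x - lie_bracket X Z x"
  by (simp add: lie_bracket_def dir_deriv_diff dir_deriv_diff_left)

lemma lie_bracket_scaleR_right:
  "X differentiable at x \<Longrightarrow> Y differentiable at x \<Longrightarrow> f differentiable at x \<Longrightarrow>
    lie_bracket X (\<lambda>y. f y *\<^sub>R Y y) x = dir_deriv X f x *\<^sub>R Y x + f x *\<^sub>R lie_bracket X Y x"
  by (simp add: lie_bracket_def dir_deriv_scaleR dir_deriv_scaleR_left algebra_simps)

lemma lie_bracket_cong_right:
  assumes "open S" "x \<in> S" "Y differentiable at x" "\<And>y. y \<in> S \<Longrightarrow> Y y = Z y"
  shows "lie_bracket X Y x = lie_bracket X Z x"
  using dir_deriv_cong[OF assms] assms(2,4) by (simp add: lie_bracket_def dir_deriv_def)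

lemma ext_deriv_tensorial:
  assumes "\<alpha> differentiable at x" "X differentiable at x" "Y differentiable at x"
  shows "ext_deriv \<alpha> X Y x = ext_deriv \<alpha> (\<lambda>_. X x) (\<lambda>_. Y x) x"
  using assms by (simp add: ext_deriv_def dir_deriv_inner lie_bracket_def algebra_simps)
    (simp add: dir_deriv_def)

lemma ext_deriv_antisym: "ext_deriv \<alpha> X Y x = - ext_deriv \<alpha> Y X x"
  by (simp add: ext_deriv_def lie_bracket_def algebra_simps)

section \<open>Affine connections: Christoffel form, restriction to open subsets, curvature as a
  tensor\<close>

lemma affine_connection_onD:
  assumes "affine_connection_on S D"
  shows "smooth_on S X \<Longrightarrow> smooth_on S Y \<Longrightarrow> smooth_on S (D X Y)"
    and "smooth_on S X \<Longrightarrow> smooth_on S X' \<Longrightarrow> smooth_on S Y \<Longrightarrow> x \<in> S \<Longrightarrow>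
       D (\<lambda>y. X y + X' y) Y x = D X Y x + D X' Y x"
    and "smooth_on S X \<Longrightarrow> smooth_on S Y \<Longrightarrow> smooth_on S Y' \<Longrightarrow> x \<in> S \<Longrightarrow>
       D X (\<lambda>y. Y y + Y' y) x = D X Y x + D X Y' x"
    and "smooth_on S f \<Longrightarrow> smooth_on S X \<Longrightarrow> smooth_on S Y \<Longrightarrow> x \<in> S \<Longrightarrow>
       D (\<lambda>y. f y *\<^sub>R X y) Y x = f x *\<^sub>R D X Y x"
    and "smooth_on S f \<Longrightarrow> smooth_on S X \<Longrightarrow> smooth_on S Y \<Longrightarrow> x \<in> S \<Longrightarrow>
       D X (\<lambda>y. f y *\<^sub>R Y y) x = dir_deriv X f x *\<^sub>R Y x + f x *\<^sub>R D X Y x"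
  using assms by (simp_all add: affine_connection_on_def)

lemma affine_connection_zero_left:
  assumes "affine_connection_on S D" "smooth_on S Y" "x \<in> S"
  shows "D (\<lambda>_. 0) Y x = 0"
  using affine_connection_onD(4)[OF assms(1), of "\<lambda>_. 0" "\<lambda>_. 0"] assms by simp

lemma affine_connection_zero_right:
  assumes "affine_connection_on S D" "smooth_on S X" "x \<in> S"
  shows "D X (\<lambda>_. 0) x = 0"
  using affine_connection_onD(5)[OF assms(1), of "\<lambda>_. 0" X "\<lambda>_. 0"] assms by simp

lemma affine_connection_sum_left:
  assumes D: "affine_connection_on S D" and S: "open S" "x \<in> S"
    and f: "\<And>i. i \<in> I \<Longrightarrow> smooth_on S (f i)" and Y: "smooth_on S Y" and "finite I"
  shows "D (\<lambda>y. \<Sum>i\<in>I. f i y *\<^sub>R e i) Y x = (\<Sum>i\<in>I. f i x *\<^sub>R D (\<lambda>_. e i) Y x)"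
  using \<open>finite I\<close> f
proof (induction I)
  case empty
  then show ?case using affine_connection_zero_left[OF D Y S(2)] by simp
next
  case (insert j I)
  then show ?case
    using affine_connection_onD(2)[OF D, of "\<lambda>y. f j y *\<^sub>R e j" "\<lambda>y. \<Sum>i\<in>I. f i y *\<^sub>R e i" Y x]
      affine_connection_onD(4)[OF D, of "f j" "\<lambda>_. e j" Y x] S Y
    by (simp add: smooth_on_scaleR smooth_on_sum)
qed

lemma affine_connection_sum_right:
  assumes D: "affine_connection_on S D" and S: "open S" "x \<in> S"
    and f: "\<And>i. i \<in> I \<Longrightarrow> smooth_on S (f i)" and X: "smooth_on S X" and "finite I"
  shows "D X (\<lambda>y. \<Sum>i\<in>I. f i y *\<^sub>R e i) x =
    (\<Sum>i\<in>I. dir_deriv X (f i) x *\<^sub>R e i + f i x *\<^sub>R D X (\<lambda>_. e i) x)"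
  using \<open>finite I\<close> f
proof (induction I)
  case empty
  then show ?case using affine_connection_zero_right[OF D X S(2)] by simp
next
  case (insert j I)
  then show ?case
    using affine_connection_onD(3)[OF D, of X "\<lambda>y. f j y *\<^sub>R e j" "\<lambda>y. \<Sum>i\<in>I. f i y *\<^sub>R e i" x]
      affine_connection_onD(5)[OF D, of "f j" X "\<lambda>_. e j" x] S X
    by (simp add: smooth_on_scaleR smooth_on_sum)
qed

lemma affine_connection_tensorial_left:
  assumes D: "affine_connection_on S D" and S: "open S" "x \<in> S"
    and X: "smooth_on S X" and Y: "smooth_on S Y"
  shows "D X Y x = D (\<lambda>_. X x) Y x"
proof -
  have "D X Y x = (\<Sum>i\<in>UNIV. X x $ i *\<^sub>R D (\<lambda>_. axis i 1) Y x)"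
    using affine_connection_sum_left[OF D S, of UNIV "\<lambda>i y. X y $ i" Y "\<lambda>i. axis i 1"] Y
      smooth_on_vec_nth[OF S(1) X] by (simp flip: vec_axis_expansion)
  also have "\<dots> = D (\<lambda>_. X x) Y x"
    using affine_connection_sum_left[OF D S, of UNIV "\<lambda>i y. X x $ i" Y "\<lambda>i. axis i 1"] Y
    by (simp flip: vec_axis_expansion)
  finally show ?thesis .
qed

text \<open>Applies to fields that are defined near \<open>x\<close> only, unlike \<open>D\<close> itself.\<close>

definition local_connection :: "'n::finite connection \<Rightarrow> 'n connection" where
  "local_connection D X Y x = dir_deriv X Y x + D (\<lambda>_. X x) (\<lambda>_. Y x) x"

text \<open>Expanding \<open>Y\<close> in the standard basis and using the Leibniz rule shows that a
  connection is determined by its values on constant fields, that is, by its Christoffel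
  symbols.\<close>

lemma affine_connection_eq_local:
  assumes D: "affine_connection_on S D" and S: "open S" "x \<in> S"
    and X: "smooth_on S X" and Y: "smooth_on S Y"
  shows "D X Y x = local_connection D X Y x"
proof -
  have "D X Y x = (\<Sum>i\<in>UNIV. dir_deriv X (\<lambda>y. Y y $ i) x *\<^sub>R axis i 1 + Y x $ i *\<^sub>R D X (\<lambda>_. axis i 1) x)"
    using affine_connection_sum_right[OF D S, of UNIV "\<lambda>i y. Y y $ i" X "\<lambda>i. axis i 1"] X
      smooth_on_vec_nth[OF S(1) Y] by (simp flip: vec_axis_expansion)
  also have "\<dots> = (\<Sum>i\<in>UNIV. dir_deriv X Y x $ i *\<^sub>R axis i 1) + (\<Sum>i\<in>UNIV. Y x $ i *\<^sub>R D X (\<lambda>_. axis i 1) x)"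
    by (simp add: sum.distrib dir_deriv_bounded_linear[OF bounded_linear_vec_nth]
        smooth_on_differentiable[OF Y S(2)])
  also have "(\<Sum>i\<in>UNIV. Y x $ i *\<^sub>R D X (\<lambda>_. axis i 1) x) = D X (\<lambda>_. Y x) x"
    using affine_connection_sum_right[OF D S, of UNIV "\<lambda>i y. Y x $ i" X "\<lambda>i. axis i 1"] X
    by (simp flip: vec_axis_expansion)
  also have "D X (\<lambda>_. Y x) x = D (\<lambda>_. X x) (\<lambda>_. Y x) x"
    by (rule affine_connection_tensorial_left[OF D S X]) simp
  finally show ?thesis by (simp add: local_connection_def flip: vec_axis_expansion)
qed

lemma local_connection_const [simp]:
  "local_connection D (\<lambda>_. u) (\<lambda>_. v) = D (\<lambda>_. u) (\<lambda>_. v)"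
  by (simp add: local_connection_def fun_eq_iff)

lemma connection_const_linear:
  assumes D: "affine_connection_on S D" and "x \<in> S"
  shows "linear (\<lambda>u. D (\<lambda>_. u) (\<lambda>_. v) x)" "linear (\<lambda>v. D (\<lambda>_. u) (\<lambda>_. v) x)"
  using affine_connection_onD(2-5)[OF D] assms(2)
  by (auto intro!: linearI simp: affine_connection_onD(4)[OF D, of "\<lambda>_. c" for c, simplified])

lemma connection_const_smooth:
  assumes D: "affine_connection_on S D"
  shows "smooth_on S (D (\<lambda>_. u) (\<lambda>_. v))"
  using affine_connection_onD(1)[OF D] by simp

lemma smooth_on_local_connection:
  assumes D: "affine_connection_on S D" and U: "open U" "U \<subseteq> S"
    and X: "smooth_on U X" and Y: "smooth_on U Y"
  shows "smooth_on U (local_connection D X Y)"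
proof -
  have "smooth_on U (\<lambda>y. D (\<lambda>_. X y) (\<lambda>_. v) y)" for v
    by (rule smooth_on_linear_family[OF U(1) X])
      (use connection_const_linear[OF D] U smooth_on_subset[OF connection_const_smooth[OF D]] in auto)
  then have "smooth_on U (\<lambda>y. D (\<lambda>_. X y) (\<lambda>_. Y y) y)"
    by (rule smooth_on_linear_family[OF U(1) Y, rotated]) (use connection_const_linear[OF D] U in auto)
  then show ?thesis
    unfolding local_connection_def[abs_def] by (intro smooth_on_add smooth_on_dir_deriv X Y U)
qed

lemma affine_connection_on_local_connection:
  fixes D :: "'n::finite connection"
  assumes D: "affine_connection_on S D" and U: "open U" "U \<subseteq> S"
  shows "affine_connection_on U (local_connection D)"
  unfolding affine_connection_on_def
proof (intro conjI allI impI ballI)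
  fix X Y :: "real ^ 'n \<Rightarrow> real ^ 'n" assume "smooth_on U X" "smooth_on U Y"
  then show "smooth_on U (local_connection D X Y)" by (rule smooth_on_local_connection[OF assms])
next
  fix X X' Y :: "real ^ 'n \<Rightarrow> real ^ 'n" and x assume "smooth_on U X" "smooth_on U X'" "smooth_on U Y" "x \<in> U"
  then show "local_connection D (\<lambda>y. X y + X' y) Y x = local_connection D X Y x + local_connection D X' Y x"
    using U linear_add[OF connection_const_linear(1)[OF D]]
    by (auto simp: local_connection_def dir_deriv_add_left smooth_on_differentiable)
next
  fix X Y Y' :: "real ^ 'n \<Rightarrow> real ^ 'n" and x assume "smooth_on U X" "smooth_on U Y" "smooth_on U Y'" "x \<in> U"
  then show "local_connection D X (\<lambda>y. Y y + Y' y) x = local_connection D X Y x + local_connection D X Y' x"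
    using U linear_add[OF connection_const_linear(2)[OF D]]
    by (auto simp: local_connection_def dir_deriv_add smooth_on_differentiable)
next
  fix f :: "real ^ 'n \<Rightarrow> real" and X Y :: "real ^ 'n \<Rightarrow> real ^ 'n" and x assume "smooth_on U f" "smooth_on U X" "smooth_on U Y" "x \<in> U"
  then show "local_connection D (\<lambda>y. f y *\<^sub>R X y) Y x = f x *\<^sub>R local_connection D X Y x"
    using U linear_cmul[OF connection_const_linear(1)[OF D]]
    by (auto simp: local_connection_def dir_deriv_scaleR_left smooth_on_differentiable algebra_simps)
next
  fix f :: "real ^ 'n \<Rightarrow> real" and X Y :: "real ^ 'n \<Rightarrow> real ^ 'n" and x assume "smooth_on U f" "smooth_on U X" "smooth_on U Y" "x \<in> U"
  then show "local_connection D X (\<lambda>y. f y *\<^sub>R Y y) x =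
      dir_deriv X f x *\<^sub>R Y x + f x *\<^sub>R local_connection D X Y x"
    using U linear_cmul[OF connection_const_linear(2)[OF D]]
    by (auto simp: local_connection_def dir_deriv_scaleR smooth_on_differentiable algebra_simps)
qed

text \<open>\<open>curvature_at\<close> extends vectors by constants, whereas the frame computations
  insert \<xi>, p, q. In Christoffel form all derivatives of \<open>X\<close>, \<open>Y\<close>,
  \<open>Z\<close> cancel: the second derivatives of \<open>Z\<close> against the bracket term, the
  first ones in pairs.\<close>

lemma curvature_op_tensorial:
  assumes D: "affine_connection_on S D" and S: "open S" "x \<in> S"
    and X: "smooth_on S X" and Y: "smooth_on S Y" and Z: "smooth_on S Z"
  shows "curvature_op D X Y Z x = curvature_at D x (X x) (Y x) (Z x)"
proof -
  define \<Gamma> where "\<Gamma> y u v = D (\<lambda>_. u) (\<lambda>_. v) y" for y u v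
  have lin: "linear (\<lambda>u. \<Gamma> y u v)" "linear (\<Gamma> y u)" if "y \<in> S" for y u v
    using connection_const_linear[OF D that] by (simp_all add: \<Gamma>_def[abs_def])
  have sm: "smooth_on S (\<lambda>y. \<Gamma> y u v)" for u v
    using connection_const_smooth[OF D] by (simp add: \<Gamma>_def[abs_def])
  have DE: "D V W y = dir_deriv V W y + \<Gamma> y (V y) (W y)"
    if "smooth_on S V" "smooth_on S W" "y \<in> S" for V W y
    using affine_connection_eq_local[OF D S(1) that(3,1,2)] by (simp add: local_connection_def \<Gamma>_def)
  have sm2: "smooth_on S (\<lambda>y. \<Gamma> y (V y) v)" if "smooth_on S V" for V v
    by (rule smooth_on_linear_family[OF S(1) that]) (auto simp: lin sm)
  have sm3: "smooth_on S (\<lambda>y. \<Gamma> y (V y) (W y))" if "smooth_on S V" "smooth_on S W" for V W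
    by (rule smooth_on_linear_family[OF S(1) that(2)]) (auto simp: lin sm2 that)
  \<comment> \<open>The product rule in both slots. The term with frozen \<open>P x\<close> and
    \<open>W x\<close> is the derivative of the Christoffel symbols, the only one that survives for
    constant fields.\<close>
  have dG: "dir_deriv V (\<lambda>y. \<Gamma> y (P y) (W y)) x = dir_deriv V (\<lambda>y. \<Gamma> y (P x) (W x)) x
      + \<Gamma> x (dir_deriv V P x) (W x) + \<Gamma> x (P x) (dir_deriv V W x)"
    if "smooth_on S P" "smooth_on S W" for V P W
    using dir_deriv_linear_family[OF S that(2), of "\<lambda>y. \<Gamma> y (P y)" V]
      dir_deriv_linear_family[OF S that(1), of "\<lambda>y u. \<Gamma> y u (W x)" V]
    by (simp add: lin sm sm2 that)
  have DD: "D V (D P W) x = dir_deriv V (dir_deriv P W) x + dir_deriv V (\<lambda>y. \<Gamma> y (P x) (W x)) x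
      + \<Gamma> x (dir_deriv V P x) (W x) + \<Gamma> x (P x) (dir_deriv V W x)
      + \<Gamma> x (V x) (dir_deriv P W x) + \<Gamma> x (V x) (\<Gamma> x (P x) (W x))"
    if V: "smooth_on S V" and P: "smooth_on S P" and W: "smooth_on S W" for V P W
  proof -
    have "dir_deriv V (D P W) x = dir_deriv V (\<lambda>y. dir_deriv P W y + \<Gamma> y (P y) (W y)) x"
      by (rule dir_deriv_cong[OF S]) (use DE P W affine_connection_onD(1)[OF D P W] S
          in \<open>auto intro: smooth_on_differentiable\<close>)
    also have "\<dots> = dir_deriv V (dir_deriv P W) x + dir_deriv V (\<lambda>y. \<Gamma> y (P y) (W y)) x"
      by (rule dir_deriv_add) (use S P W in \<open>auto intro!: smooth_on_differentiable sm3 smooth_on_dir_deriv\<close>)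
    finally show ?thesis
      using DE[OF V affine_connection_onD(1)[OF D P W] S(2)] DE[OF P W S(2)]
      by (simp add: dG[OF P W] linear_add[OF lin(2)] S)
  qed
  have 1: "D (lie_bracket X Y) Z x = dir_deriv (lie_bracket X Y) Z x
      + \<Gamma> x (dir_deriv X Y x) (Z x) - \<Gamma> x (dir_deriv Y X x) (Z x)"
    using DE[OF smooth_on_lie_bracket[OF S(1) X Y] Z S(2)]
    by (simp add: lie_bracket_def linear_diff[OF lin(1)[OF S(2)]])
  have c: "D (\<lambda>_. 0) (\<lambda>_. w) x = 0" for w
    using affine_connection_zero_left[OF D _ S(2), of "\<lambda>_. w"] by simp
  have "dir_deriv X (dir_deriv Y Z) x = dir_deriv Y (dir_deriv X Z) x + dir_deriv (lie_bracket X Y) Z x"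
    using dir_deriv_commutator[OF S X Y Z] by (simp add: algebra_simps)
  then show ?thesis
    by (simp add: curvature_at_def curvature_op_def DD X Y Z 1 c linear_0[OF lin(1)[OF S(2)]]
        linear_0[OF lin(2)[OF S(2)]]) (simp add: dir_deriv_def)
qed

text \<open>A connection acts on total functions, and its axioms do not mention fields that agree
  only on \<open>S\<close>. The Christoffel form shows that such fields have the same covariant
  derivative on \<open>S\<close>.\<close>

lemma affine_connection_cong_right:
  assumes D: "affine_connection_on S D" and S: "open S" "x \<in> S"
    and X: "smooth_on S X" and Y: "smooth_on S Y" "smooth_on S Z" "\<And>y. y \<in> S \<Longrightarrow> Y y = Z y"
  shows "D X Y x = D X Z x"
proof -
  have "dir_deriv X Y x = dir_deriv X Z x"
    by (rule dir_deriv_cong[OF S smooth_on_differentiable[OF Y(1) S(2)] Y(3)])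
  then show ?thesis
    unfolding affine_connection_eq_local[OF D S X Y(1)] affine_connection_eq_local[OF D S X Y(2)]
    by (simp add: local_connection_def Y(3)[OF S(2)])
qed

lemma curvature_at_eq:
  assumes "affine_connection_on S D" "x \<in> S"
  shows "curvature_at D x u v w =
    D (\<lambda>_. u) (D (\<lambda>_. v) (\<lambda>_. w)) x - D (\<lambda>_. v) (D (\<lambda>_. u) (\<lambda>_. w)) x"
  using affine_connection_zero_left[OF assms(1) smooth_on_const assms(2)]
  by (simp add: curvature_at_def curvature_op_def)

text \<open>For constant arguments the curvature involves only \<open>D\<close> of constant fields
  and \<open>D\<close> of those results. All these fields are smooth on \<open>S\<close>, where
  \<open>D\<close> and its Christoffel form coincide.\<close>

lemma curvature_at_local_connection:
  assumes D: "affine_connection_on S D" and S: "open S" and U: "open U" "U \<subseteq> S" "x \<in> U"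
  shows "curvature_at (local_connection D) x u v w = curvature_at D x u v w"
proof -
  have x: "x \<in> S" using U by auto
  have "D (\<lambda>_. a) (D (\<lambda>_. b) (\<lambda>_. c)) x = local_connection D (\<lambda>_. a) (D (\<lambda>_. b) (\<lambda>_. c)) x" for a b c
    by (rule affine_connection_eq_local[OF D S x smooth_on_const connection_const_smooth[OF D]])
  then show ?thesis
    by (simp add: curvature_at_eq[OF D x]
        curvature_at_eq[OF affine_connection_on_local_connection[OF D U(1,2)] U(3)])
qed

lemma curvature_at_linear:
  assumes D: "affine_connection_on S D" and S: "open S" "x \<in> S"
  shows "linear (\<lambda>u. curvature_at D x u v w)" "linear (\<lambda>v. curvature_at D x u v w)"
    "linear (\<lambda>w. curvature_at D x u v w)"
proof -
  note sm = connection_const_smooth[OF D]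
  note lin = connection_const_linear[OF D]
  define E where "E u v w = D (\<lambda>_. u) (D (\<lambda>_. v) (\<lambda>_. w)) x" for u v w
  have "linear (\<lambda>u. E u v w)" for v w
    using affine_connection_onD(2)[OF D smooth_on_const smooth_on_const sm S(2)]
      affine_connection_onD(4)[OF D smooth_on_const smooth_on_const sm S(2)]
    by (auto intro!: linearI simp: E_def)
  \<comment> \<open>Linearity of the inner \<open>D\<close> holds at the points of \<open>S\<close>
    only, hence it is moved under the outer \<open>D\<close> by congruence on \<open>S\<close> and
    not by rewriting.\<close>
  moreover have "linear (\<lambda>v. E u v w)" "linear (\<lambda>v. E u w v)" for u w
    unfolding E_def
    by (rule linearI;
        subst affine_connection_cong_right[OF D S smooth_on_const sm _ linear_add[OF lin(1)]]
          affine_connection_cong_right[OF D S smooth_on_const sm _ linear_add[OF lin(2)]]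
          affine_connection_cong_right[OF D S smooth_on_const sm _ linear_cmul[OF lin(1)]]
          affine_connection_cong_right[OF D S smooth_on_const sm _ linear_cmul[OF lin(2)]];
        simp add: affine_connection_onD(3)[OF D smooth_on_const sm sm S(2)]
          affine_connection_onD(5)[OF D smooth_on_const smooth_on_const sm S(2)]
          smooth_on_add smooth_on_scaleR sm S)+
  ultimately show "linear (\<lambda>u. curvature_at D x u v w)" "linear (\<lambda>v. curvature_at D x u v w)"
    "linear (\<lambda>w. curvature_at D x u v w)"
    unfolding curvature_at_eq[OF D S(2)] E_def[symmetric] by (auto intro: linear_compose_sub)
qed

section \<open>Null frames\<close>

lemma bilin_linear:
  shows bilin_add_left: "bilin G (u + v) w = bilin G u w + bilin G v w"
    and bilin_add_right: "bilin G u (v + w) = bilin G u v + bilin G u w"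
    and bilin_diff_left: "bilin G (u - v) w = bilin G u w - bilin G v w"
    and bilin_diff_right: "bilin G u (v - w) = bilin G u v - bilin G u w"
    and bilin_scaleR_left: "bilin G (c *\<^sub>R u) w = c * bilin G u w"
    and bilin_scaleR_right: "bilin G u (c *\<^sub>R w) = c * bilin G u w"
    and bilin_minus_left: "bilin G (- u) w = - bilin G u w"
    and bilin_minus_right: "bilin G u (- w) = - bilin G u w"
    and bilin_zero_left [simp]: "bilin G 0 w = 0"
    and bilin_zero_right [simp]: "bilin G u 0 = 0"
proof -
  have l: "linear (\<lambda>u. bilin G u w)" "linear (bilin G u)" for u w
    by (auto intro!: linearI simp: bilin_def algebra_simps)
  show "bilin G (u + v) w = bilin G u w + bilin G v w" "bilin G u (v + w) = bilin G u v + bilin G u w"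
    "bilin G (u - v) w = bilin G u w - bilin G v w" "bilin G u (v - w) = bilin G u v - bilin G u w"
    "bilin G (c *\<^sub>R u) w = c * bilin G u w" "bilin G u (c *\<^sub>R w) = c * bilin G u w"
    "bilin G (- u) w = - bilin G u w" "bilin G u (- w) = - bilin G u w"
    "bilin G 0 w = 0" "bilin G u 0 = 0"
    using l[THEN linear_add] l[THEN linear_diff] l[THEN linear_cmul] l[THEN linear_neg] l[THEN linear_0]
    by simp_all
qed

text \<open>With \<open>\<eta> = g(\<cdot>,\<xi>)\<close>, the assumptions \<open>contact\<close> say that \<open>d\<eta>(p,q) = -1\<close> and \<open>d\<eta>(\<xi>,\<cdot>) = 0\<close>.\<close>

locale null_frame =
  fixes U :: "(real ^ 3) set" and g :: "real ^ 3 \<Rightarrow> real ^ 3 ^ 3" and D :: "3 connection"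
    and \<xi> p q :: "real ^ 3 \<Rightarrow> real ^ 3"
  assumes U: "open U" and LC: "levi_civita_on U g D"
    and smooth_g: "smooth_on U g"
    and smooth_frame [simp]: "smooth_on U \<xi>" "smooth_on U p" "smooth_on U q"
    and g_sym: "x \<in> U \<Longrightarrow> bilin (g x) u v = bilin (g x) v u"
    and gram: "x \<in> U \<Longrightarrow> bilin (g x) (\<xi> x) (\<xi> x) = 1" "x \<in> U \<Longrightarrow> bilin (g x) (p x) (q x) = 1"
      "x \<in> U \<Longrightarrow> bilin (g x) (p x) (p x) = 0" "x \<in> U \<Longrightarrow> bilin (g x) (q x) (q x) = 0"
      "x \<in> U \<Longrightarrow> bilin (g x) (\<xi> x) (p x) = 0" "x \<in> U \<Longrightarrow> bilin (g x) (\<xi> x) (q x) = 0"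
    and contact: "x \<in> U \<Longrightarrow> bilin (g x) (lie_bracket p q x) (\<xi> x) = 2"
      "x \<in> U \<Longrightarrow> bilin (g x) (lie_bracket \<xi> p x) (\<xi> x) = 0"
      "x \<in> U \<Longrightarrow> bilin (g x) (lie_bracket \<xi> q x) (\<xi> x) = 0"
begin

lemma affine: "affine_connection_on U D"
  using LC by (simp add: levi_civita_on_def)

lemma torsion_free:
  "smooth_on U X \<Longrightarrow> smooth_on U Y \<Longrightarrow> x \<in> U \<Longrightarrow> lie_bracket X Y x = D X Y x - D Y X x"
  using LC by (simp add: levi_civita_on_def)

lemma metric:
  "smooth_on U X \<Longrightarrow> smooth_on U Y \<Longrightarrow> smooth_on U Z \<Longrightarrow> x \<in> U \<Longrightarrow>
    dir_deriv X (\<lambda>y. bilin (g y) (Y y) (Z y)) x =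
      bilin (g x) (D X Y x) (Z x) + bilin (g x) (Y x) (D X Z x)"
  using LC by (simp add: levi_civita_on_def)

lemmas smooth_D [simp] = affine_connection_onD(1)[OF affine]

lemma gram': assumes "x \<in> U"
  shows "bilin (g x) (q x) (p x) = 1" "bilin (g x) (p x) (\<xi> x) = 0" "bilin (g x) (q x) (\<xi> x) = 0"
  using gram[OF assms] g_sym[OF assms] by metis+

text \<open>The dual basis of \<xi>, p, q with respect to \<open>g\<close> is \<xi>, q, p. This is
  why the coefficient of \<open>p x\<close> is the product with \<open>q x\<close>, here and in all
  later frame formulas.\<close>

lemma frame_expand:
  assumes x: "x \<in> U"
  shows "u = bilin (g x) u (\<xi> x) *\<^sub>R \<xi> x + bilin (g x) u (q x) *\<^sub>R p x + bilin (g x) u (p x) *\<^sub>R q x"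
proof -
  note s = gram[OF x] gram'[OF x]
  let ?B = "{\<xi> x, p x, q x}"
  have "\<xi> x \<noteq> p x" "\<xi> x \<noteq> q x" "p x \<noteq> q x"
    using s by auto
  then have card: "card ?B = 3" by simp
  have "independent ?B"
  proof (rule independent_if_scalars_zero)
    fix f :: "real ^ 3 \<Rightarrow> real" and w
    assume "(\<Sum>v\<in>?B. f v *\<^sub>R v) = 0" and w: "w \<in> ?B"
    then have z: "f (\<xi> x) *\<^sub>R \<xi> x + (f (p x) *\<^sub>R p x + f (q x) *\<^sub>R q x) = 0"
      using \<open>\<xi> x \<noteq> p x\<close> \<open>\<xi> x \<noteq> q x\<close> \<open>p x \<noteq> q x\<close> by simp
    show "f w = 0"
      using w arg_cong[OF z, of "\<lambda>v. bilin (g x) v (\<xi> x)"] arg_cong[OF z, of "\<lambda>v. bilin (g x) v (p x)"]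
        arg_cong[OF z, of "\<lambda>v. bilin (g x) v (q x)"] s
      by (auto simp: bilin_linear)
  qed simp
  then have "UNIV \<subseteq> span ?B"
    by (intro card_ge_dim_independent) (auto simp: card)
  then have "u \<in> span ?B" by auto
  then obtain a b c where "u = a *\<^sub>R \<xi> x + b *\<^sub>R p x + c *\<^sub>R q x"
    by (auto simp: span_insert span_empty algebra_simps)
  then show ?thesis
    using s by (simp add: bilin_linear)
qed

lemma frame_eqI:
  assumes "x \<in> U" "bilin (g x) u (\<xi> x) = bilin (g x) v (\<xi> x)"
    "bilin (g x) u (p x) = bilin (g x) v (p x)" "bilin (g x) u (q x) = bilin (g x) v (q x)"
  shows "u = v"
  using frame_expand[OF assms(1), of u] frame_expand[OF assms(1), of v] assms(2-4) by simp

lemma frame_inner: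
  assumes x: "x \<in> U"
  shows "bilin (g x) u v = bilin (g x) u (\<xi> x) * bilin (g x) v (\<xi> x)
    + bilin (g x) u (q x) * bilin (g x) v (p x) + bilin (g x) u (p x) * bilin (g x) v (q x)"
  by (subst frame_expand[OF x, of v]) (simp add: bilin_linear)

lemma frame_trace:
  assumes x: "x \<in> U" and L: "linear L"
  shows "trace (matrix L) = bilin (g x) (L (\<xi> x)) (\<xi> x) + bilin (g x) (L (p x)) (q x)
    + bilin (g x) (L (q x)) (p x)"
proof -
  have *: "(\<Sum>i\<in>UNIV. bilin (g x) (axis i 1) v * w $ i) = bilin (g x) w v" for v w
  proof -
    have "linear (\<lambda>u. bilin (g x) u v)" by (auto intro!: linearI simp: bilin_linear)
    from linear_axis_expansion[OF this, of w] show ?thesis by (simp add: mult.commute)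
  qed
  have Lv: "L v = bilin (g x) v (\<xi> x) *\<^sub>R L (\<xi> x) + bilin (g x) v (q x) *\<^sub>R L (p x) + bilin (g x) v (p x) *\<^sub>R L (q x)" for v
    by (subst frame_expand[OF x, of v]) (simp add: linear_add[OF L] linear_cmul[OF L])
  have c: "L v $ i = bilin (g x) v (\<xi> x) * L (\<xi> x) $ i + bilin (g x) v (q x) * L (p x) $ i
      + bilin (g x) v (p x) * L (q x) $ i" for v i
    using arg_cong[OF Lv[of v], of "\<lambda>w. w $ i"] by simp
  have "trace (matrix L) = (\<Sum>i\<in>UNIV. L (axis i 1) $ i)"
    by (simp add: trace_def matrix_def)
  also have "\<dots> = (\<Sum>i\<in>UNIV. bilin (g x) (axis i 1) (\<xi> x) * L (\<xi> x) $ i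
      + bilin (g x) (axis i 1) (q x) * L (p x) $ i + bilin (g x) (axis i 1) (p x) * L (q x) $ i)"
    by (intro sum.cong refl c)
  finally show ?thesis by (simp add: sum.distrib *)
qed

section \<open>Connection coefficients, structure equations and curvature of a null frame\<close>

text \<open>For frame fields these are the connection coefficients g(\<nabla>_X Y, Z). The arguments
  are arbitrary fields, so that the direction may also be a bracket, as the curvature
  requires.\<close>

definition cov :: "(real ^ 3 \<Rightarrow> real ^ 3) \<Rightarrow> (real ^ 3 \<Rightarrow> real ^ 3) \<Rightarrow> (real ^ 3 \<Rightarrow> real ^ 3) \<Rightarrow> real ^ 3 \<Rightarrow> real"
  where "cov X Y Z x = bilin (g x) (D X Y x) (Z x)"

lemma smooth_cov [simp]:
  "smooth_on U X \<Longrightarrow> smooth_on U Y \<Longrightarrow> smooth_on U Z \<Longrightarrow> smooth_on U (cov X Y Z)"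
  unfolding cov_def[abs_def] by (intro smooth_on_bilin smooth_g U smooth_D)

lemma cov_antisym:
  assumes "smooth_on U X" "smooth_on U Y" "smooth_on U Z" "x \<in> U"
    and c: "\<And>y. y \<in> U \<Longrightarrow> bilin (g y) (Y y) (Z y) = c"
  shows "cov X Y Z x = - cov X Z Y x"
proof -
  have "dir_deriv X (\<lambda>y. bilin (g y) (Y y) (Z y)) x = dir_deriv X (\<lambda>y. c) x"
    by (rule dir_deriv_cong[OF U assms(4) smooth_on_differentiable[OF _ assms(4)]])
      (auto intro!: smooth_on_bilin U smooth_g assms)
  then show ?thesis
    using metric[OF assms(1-4)] g_sym[OF assms(4), of "Y x" "D X Z x"] by (simp add: cov_def)
qed

lemma frame_cov:
  assumes X: "smooth_on U X" and x: "x \<in> U"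
  shows "cov X p p x = 0" "cov X q q x = 0" "cov X \<xi> \<xi> x = 0" "cov X q p x = - cov X p q x"
    "cov X \<xi> p x = - cov X p \<xi> x" "cov X \<xi> q x = - cov X q \<xi> x"
  using cov_antisym[OF X _ _ x] gram gram' smooth_frame
  by (metis (no_types, lifting) add.inverse_neutral neg_equal_zero)+

text \<open>\<open>D\<close> is tensorial in its direction, so the bracket may be expanded in the
  frame at the point.\<close>

lemma cov_bracket:
  assumes X: "smooth_on U X" "smooth_on U Y" "smooth_on U Z" "smooth_on U W" and x: "x \<in> U"
  shows "cov (lie_bracket X Y) Z W x = bilin (g x) (lie_bracket X Y x) (\<xi> x) * cov \<xi> Z W x
    + bilin (g x) (lie_bracket X Y x) (q x) * cov p Z W x + bilin (g x) (lie_bracket X Y x) (p x) * cov q Z W x"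
proof -
  note t = affine_connection_tensorial_left[OF affine U x _ X(3)]
  have lin: "linear (\<lambda>v. D (\<lambda>_. v) Z x)"
    using affine_connection_onD(2,4)[OF affine] X(3) x by (auto intro!: linearI)
  show ?thesis
    unfolding cov_def t[OF smooth_on_lie_bracket[OF U X(1,2)]] t[OF smooth_frame(1)]
      t[OF smooth_frame(2)] t[OF smooth_frame(3)]
    by (subst frame_expand[OF x, of "lie_bracket X Y x"])
      (simp add: linear_add[OF lin] linear_cmul[OF lin] bilin_linear)
qed

text \<open>Metric compatibility turns g(\<nabla>_X \<nabla>_Y Z, W) into the derivative of a
  coefficient minus g(\<nabla>_Y Z, \<nabla>_X W); the latter is expanded with the Gram matrix of
  the null frame, where p pairs with q.\<close>

lemma curvature_cov:
  assumes X: "smooth_on U X" and Y: "smooth_on U Y" and Z: "smooth_on U Z" and W: "smooth_on U W"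
    and x: "x \<in> U"
  shows "bilin (g x) (curvature_at D x (X x) (Y x) (Z x)) (W x) =
    dir_deriv X (cov Y Z W) x - dir_deriv Y (cov X Z W) x
    - (cov Y Z \<xi> x * cov X W \<xi> x + cov Y Z q x * cov X W p x + cov Y Z p x * cov X W q x)
    + (cov X Z \<xi> x * cov Y W \<xi> x + cov X Z q x * cov Y W p x + cov X Z p x * cov Y W q x)
    - cov (lie_bracket X Y) Z W x"
proof -
  have "curvature_at D x (X x) (Y x) (Z x) = curvature_op D X Y Z x"
    by (rule curvature_op_tensorial[OF affine U x X Y Z, symmetric])
  moreover have "bilin (g x) (D X (D Y Z) x) (W x) = dir_deriv X (cov Y Z W) x
      - bilin (g x) (D Y Z x) (D X W x)" if "smooth_on U X" "smooth_on U Y" for X Y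
    using metric[OF that(1) smooth_D[OF that(2) Z] W x] by (simp add: cov_def[abs_def])
  ultimately show ?thesis
    using frame_inner[OF x, of "D Y Z x" "D X W x"] frame_inner[OF x, of "D X Z x" "D Y W x"]
    by (simp add: curvature_op_def bilin_linear X Y cov_def)
qed

text \<open>The \<alpha> are the values on \<xi>, p, q of the connection form g(\<nabla> p, q). By
  \<open>frame_cov\<close>, \<open>contact_cov\<close> and \<open>cov_pq\<close> every other
  coefficient of the frame is constant or equals one of these five functions up to sign.\<close>

abbreviation "a \<equiv> cov p p \<xi>"
abbreviation "e \<equiv> cov q q \<xi>"
abbreviation "\<alpha>\<^sub>0 \<equiv> cov \<xi> p q"
abbreviation "\<alpha>\<^sub>1 \<equiv> cov p p q"
abbreviation "\<alpha>\<^sub>2 \<equiv> cov q p q"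

lemma cov_bracket_components:
  assumes "smooth_on U X" "smooth_on U Y" "x \<in> U"
  shows "bilin (g x) (lie_bracket X Y x) (Z x) = cov X Y Z x - cov Y X Z x"
  by (simp add: torsion_free[OF assms] bilin_linear cov_def)

lemma contact_cov:
  assumes x: "x \<in> U"
  shows "cov \<xi> p \<xi> x = 0" "cov \<xi> q \<xi> x = 0" "cov p q \<xi> x - cov q p \<xi> x = 2"
  using contact[OF x] by (simp_all add: cov_bracket_components frame_cov x)

text \<open>Brackets follow from the coefficients because the torsion vanishes. The contact
  condition only fixes the difference of \<open>cov p q \<xi>\<close> and
  \<open>cov q p \<xi>\<close>, so at this stage both remain in the formulas.\<close>

lemma brackets_aux:
  assumes x: "x \<in> U"
  shows "lie_bracket \<xi> p x = (\<alpha>\<^sub>0 x + cov p q \<xi> x) *\<^sub>R p x + a x *\<^sub>R q x"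
    and "lie_bracket \<xi> q x = e x *\<^sub>R p x - (\<alpha>\<^sub>0 x - cov q p \<xi> x) *\<^sub>R q x"
    and "lie_bracket p q x = 2 *\<^sub>R \<xi> x - \<alpha>\<^sub>2 x *\<^sub>R p x - \<alpha>\<^sub>1 x *\<^sub>R q x"
  by (rule frame_eqI[OF x];
      simp add: cov_bracket_components x frame_cov contact_cov bilin_linear gram gram')+

lemma differentiable_frame [simp]:
  "x \<in> U \<Longrightarrow> \<xi> differentiable at x" "x \<in> U \<Longrightarrow> p differentiable at x" "x \<in> U \<Longrightarrow> q differentiable at x"
  using smooth_frame[THEN smooth_on_differentiable] by blast+

lemma differentiable_cov [simp]:
  "x \<in> U \<Longrightarrow> smooth_on U X \<Longrightarrow> smooth_on U Y \<Longrightarrow> smooth_on U Z \<Longrightarrow> cov X Y Z differentiable at x"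
  using smooth_on_differentiable[OF smooth_cov] by blast

text \<open>The Jacobi identity for \<xi>, p, q, with the inner brackets replaced by their frame
  expansions and the outer ones expanded by the Leibniz rule. Its three frame components are
  extracted separately later.\<close>

lemma jacobi_aux:
  assumes x: "x \<in> U"
  shows "- dir_deriv \<xi> \<alpha>\<^sub>2 x *\<^sub>R p x - \<alpha>\<^sub>2 x *\<^sub>R lie_bracket \<xi> p x
      - dir_deriv \<xi> \<alpha>\<^sub>1 x *\<^sub>R q x - \<alpha>\<^sub>1 x *\<^sub>R lie_bracket \<xi> q x =
    (\<alpha>\<^sub>0 x + cov p q \<xi> x) *\<^sub>R lie_bracket p q x
      - dir_deriv q (\<lambda>y. \<alpha>\<^sub>0 y + cov p q \<xi> y) x *\<^sub>R p x - dir_deriv q a x *\<^sub>R q x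
    + dir_deriv p e x *\<^sub>R p x - dir_deriv p (\<lambda>y. \<alpha>\<^sub>0 y - cov q p \<xi> y) x *\<^sub>R q x
      - (\<alpha>\<^sub>0 x - cov q p \<xi> x) *\<^sub>R lie_bracket p q x"
proof -
  have d: "lie_bracket X Y differentiable at x" if "smooth_on U X" "smooth_on U Y" for X Y
    by (rule smooth_on_differentiable[OF smooth_on_lie_bracket[OF U that] x])
  have "lie_bracket \<xi> (lie_bracket p q) x =
      lie_bracket \<xi> (\<lambda>y. 2 *\<^sub>R \<xi> y - \<alpha>\<^sub>2 y *\<^sub>R p y - \<alpha>\<^sub>1 y *\<^sub>R q y) x"
    by (rule lie_bracket_cong_right[OF U x d]) (simp_all add: brackets_aux)
  also have "\<dots> = - dir_deriv \<xi> \<alpha>\<^sub>2 x *\<^sub>R p x - \<alpha>\<^sub>2 x *\<^sub>R lie_bracket \<xi> p x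
      - dir_deriv \<xi> \<alpha>\<^sub>1 x *\<^sub>R q x - \<alpha>\<^sub>1 x *\<^sub>R lie_bracket \<xi> q x"
    using x by (simp add: lie_bracket_diff_right lie_bracket_scaleR_right)
  finally have 1: "lie_bracket \<xi> (lie_bracket p q) x = \<dots>" .
  have "lie_bracket q (lie_bracket \<xi> p) x =
      lie_bracket q (\<lambda>y. (\<alpha>\<^sub>0 y + cov p q \<xi> y) *\<^sub>R p y + a y *\<^sub>R q y) x"
    by (rule lie_bracket_cong_right[OF U x d]) (simp_all add: brackets_aux)
  also have "\<dots> = (\<alpha>\<^sub>0 x + cov p q \<xi> x) *\<^sub>R lie_bracket q p x
      + dir_deriv q (\<lambda>y. \<alpha>\<^sub>0 y + cov p q \<xi> y) x *\<^sub>R p x + dir_deriv q a x *\<^sub>R q x"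
    using x by (simp add: lie_bracket_add_right lie_bracket_scaleR_right)
  finally have 2: "lie_bracket (lie_bracket \<xi> p) q x = (\<alpha>\<^sub>0 x + cov p q \<xi> x) *\<^sub>R lie_bracket p q x
      - dir_deriv q (\<lambda>y. \<alpha>\<^sub>0 y + cov p q \<xi> y) x *\<^sub>R p x - dir_deriv q a x *\<^sub>R q x"
    by (simp add: lie_bracket_antisym[of "lie_bracket \<xi> p" q] lie_bracket_antisym[of q p])
  have "lie_bracket p (lie_bracket \<xi> q) x =
      lie_bracket p (\<lambda>y. e y *\<^sub>R p y - (\<alpha>\<^sub>0 y - cov q p \<xi> y) *\<^sub>R q y) x"
    by (rule lie_bracket_cong_right[OF U x d]) (simp_all add: brackets_aux)
  also have "\<dots> = dir_deriv p e x *\<^sub>R p x - dir_deriv p (\<lambda>y. \<alpha>\<^sub>0 y - cov q p \<xi> y) x *\<^sub>R q x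
      - (\<alpha>\<^sub>0 x - cov q p \<xi> x) *\<^sub>R lie_bracket p q x"
    using x by (simp add: lie_bracket_diff_right lie_bracket_scaleR_right)
  finally show ?thesis
    using lie_bracket_jacobi[OF U x smooth_frame] by (simp add: 1 2)
qed

text \<open>The \<open>\<xi>\<close>-component of the Jacobi identity, i.e. \<open>d (d\<eta>) = 0\<close>.\<close>

lemma cov_pq:
  assumes x: "x \<in> U"
  shows "cov p q \<xi> x = 1" "cov q p \<xi> x = -1"
proof -
  \<comment> \<open>In the \<xi>-component only the two terms with [p,q] survive, each with the
    factor 2 from \<open>contact\<close>. The two coefficients thus have sum 0, and their difference
    is 2.\<close>
  have "(\<alpha>\<^sub>0 x + cov p q \<xi> x) * 2 - (\<alpha>\<^sub>0 x - cov q p \<xi> x) * 2 = 0"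
    using arg_cong[OF jacobi_aux[OF x], of "\<lambda>v. bilin (g x) v (\<xi> x)"]
    by (simp add: bilin_linear gram gram' contact x)
  with contact_cov(3)[OF x] show "cov p q \<xi> x = 1" "cov q p \<xi> x = -1" by simp_all
qed

lemma brackets:
  assumes x: "x \<in> U"
  shows "lie_bracket \<xi> p x = (1 + \<alpha>\<^sub>0 x) *\<^sub>R p x + a x *\<^sub>R q x"
    and "lie_bracket \<xi> q x = e x *\<^sub>R p x - (1 + \<alpha>\<^sub>0 x) *\<^sub>R q x"
    and "lie_bracket p q x = 2 *\<^sub>R \<xi> x - \<alpha>\<^sub>2 x *\<^sub>R p x - \<alpha>\<^sub>1 x *\<^sub>R q x"
  using brackets_aux[OF x] by (simp_all add: cov_pq x add.commute)

lemma dir_deriv_eq_const: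
  assumes "x \<in> U" "\<And>y. y \<in> U \<Longrightarrow> f y = c"
  shows "dir_deriv X f x = 0"
  using dir_deriv_cong[OF U assms(1), of "\<lambda>_. c" f X] assms(2) by simp

text \<open>The p- and q-components, obtained by pairing with q and p. They trade the derivatives of
  the connection form along \<xi> for derivatives of \<open>\<alpha>\<^sub>0\<close>,
  \<open>a\<close> and \<open>e\<close>.\<close>

lemma jacobi:
  assumes x: "x \<in> U"
  shows "dir_deriv \<xi> \<alpha>\<^sub>2 x = dir_deriv q \<alpha>\<^sub>0 x - dir_deriv p e x - (1 + \<alpha>\<^sub>0 x) * \<alpha>\<^sub>2 x - e x * \<alpha>\<^sub>1 x"
    and "dir_deriv \<xi> \<alpha>\<^sub>1 x = dir_deriv p \<alpha>\<^sub>0 x + dir_deriv q a x + (1 + \<alpha>\<^sub>0 x) * \<alpha>\<^sub>1 x - a x * \<alpha>\<^sub>2 x"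
proof -
  have "dir_deriv q (\<lambda>y. \<alpha>\<^sub>0 y + cov p q \<xi> y) x = dir_deriv q \<alpha>\<^sub>0 x"
    "dir_deriv p (\<lambda>y. \<alpha>\<^sub>0 y - cov q p \<xi> y) x = dir_deriv p \<alpha>\<^sub>0 x"
    using x by (simp_all add: dir_deriv_add dir_deriv_diff dir_deriv_eq_const[OF x cov_pq(1)]
        dir_deriv_eq_const[OF x cov_pq(2)])
  note j = jacobi_aux[OF x, unfolded this]
  show "dir_deriv \<xi> \<alpha>\<^sub>2 x = dir_deriv q \<alpha>\<^sub>0 x - dir_deriv p e x - (1 + \<alpha>\<^sub>0 x) * \<alpha>\<^sub>2 x - e x * \<alpha>\<^sub>1 x"
    using arg_cong[OF j, of "\<lambda>v. bilin (g x) v (q x)"]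
    by (simp add: bilin_linear gram gram' brackets x cov_pq algebra_simps)
  show "dir_deriv \<xi> \<alpha>\<^sub>1 x = dir_deriv p \<alpha>\<^sub>0 x + dir_deriv q a x + (1 + \<alpha>\<^sub>0 x) * \<alpha>\<^sub>1 x - a x * \<alpha>\<^sub>2 x"
    using arg_cong[OF j, of "\<lambda>v. bilin (g x) v (p x)"]
    by (simp add: bilin_linear gram gram' brackets x cov_pq algebra_simps)
qed

lemma dir_deriv_frame_cov:
  assumes x: "x \<in> U" and X: "smooth_on U X"
  shows "dir_deriv V (cov X p p) x = 0" "dir_deriv V (cov X q q) x = 0"
    "dir_deriv V (cov X \<xi> \<xi>) x = 0" "dir_deriv V (cov X q p) x = - dir_deriv V (cov X p q) x"
    "dir_deriv V (cov X \<xi> p) x = - dir_deriv V (cov X p \<xi>) x"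
    "dir_deriv V (cov X \<xi> q) x = - dir_deriv V (cov X q \<xi>) x"
  using frame_cov[OF X]
  by (simp_all add: dir_deriv_eq_const[OF x] X x flip: dir_deriv_minus)
    (rule dir_deriv_cong[OF U x]; simp add: x X)+

text \<open>Items 1-4 are what the Ricci conditions reduce to, items 5-8 enter the \<xi>-sectional
  curvature, items 9-12 the plane of p and q. The general symmetries of the curvature tensor are not
  proved; the instances that are needed come out of the same computation.\<close>

lemma curvature_frame:
  assumes x: "x \<in> U"
  shows "bilin (g x) (curvature_at D x (\<xi> x) (p x) (p x)) (\<xi> x) = dir_deriv \<xi> a x - 2 * \<alpha>\<^sub>0 x * a x"
    and "bilin (g x) (curvature_at D x (\<xi> x) (q x) (q x)) (\<xi> x) = dir_deriv \<xi> e x + 2 * \<alpha>\<^sub>0 x * e x"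
    and "bilin (g x) (curvature_at D x (q x) (p x) (\<xi> x)) (p x) = 2 * a x * \<alpha>\<^sub>2 x - dir_deriv q a x"
    and "bilin (g x) (curvature_at D x (p x) (q x) (\<xi> x)) (q x) = - 2 * e x * \<alpha>\<^sub>1 x - dir_deriv p e x"
    and "bilin (g x) (curvature_at D x (p x) (\<xi> x) (\<xi> x)) (p x) = dir_deriv \<xi> a x - 2 * \<alpha>\<^sub>0 x * a x"
    and "bilin (g x) (curvature_at D x (q x) (\<xi> x) (\<xi> x)) (q x) = dir_deriv \<xi> e x + 2 * \<alpha>\<^sub>0 x * e x"
    and "bilin (g x) (curvature_at D x (p x) (\<xi> x) (\<xi> x)) (q x) = - 1 - a x * e x"
    and "bilin (g x) (curvature_at D x (q x) (\<xi> x) (\<xi> x)) (p x) = - 1 - a x * e x"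
    and "bilin (g x) (curvature_at D x (p x) (q x) (p x)) (q x) = dir_deriv p \<alpha>\<^sub>2 x - dir_deriv q \<alpha>\<^sub>1 x
      + 1 + a x * e x - 2 * \<alpha>\<^sub>0 x + 2 * \<alpha>\<^sub>1 x * \<alpha>\<^sub>2 x"
    and "bilin (g x) (curvature_at D x (p x) (q x) (q x)) (p x) = - (dir_deriv p \<alpha>\<^sub>2 x - dir_deriv q \<alpha>\<^sub>1 x
      + 1 + a x * e x - 2 * \<alpha>\<^sub>0 x + 2 * \<alpha>\<^sub>1 x * \<alpha>\<^sub>2 x)"
    and "bilin (g x) (curvature_at D x (p x) (q x) (p x)) (p x) = 0"
    and "bilin (g x) (curvature_at D x (p x) (q x) (q x)) (q x) = 0"
  by (simp_all add: curvature_cov x cov_bracket frame_cov contact_cov(1,2) cov_pq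
      brackets bilin_linear gram gram' dir_deriv_frame_cov
      lie_bracket_antisym[of q p] lie_bracket_antisym[of p \<xi>] lie_bracket_antisym[of q \<xi>]
      dir_deriv_eq_const[OF x contact_cov(1)] dir_deriv_eq_const[OF x contact_cov(2)]
      dir_deriv_eq_const[OF x cov_pq(1)] dir_deriv_eq_const[OF x cov_pq(2)] algebra_simps)

end

text \<open>The conditions \<open>Ric(p,p) = Ric(q,q) = Ric(p,\<xi>) = Ric(q,\<xi>) = 0\<close>.\<close>

locale commuting_null_frame = null_frame +
  assumes ricci: "x \<in> U \<Longrightarrow> bilin (g x) (curvature_at D x (\<xi> x) (p x) (p x)) (\<xi> x) = 0"
    "x \<in> U \<Longrightarrow> bilin (g x) (curvature_at D x (\<xi> x) (q x) (q x)) (\<xi> x) = 0"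
    "x \<in> U \<Longrightarrow> bilin (g x) (curvature_at D x (q x) (p x) (\<xi> x)) (p x) = 0"
    "x \<in> U \<Longrightarrow> bilin (g x) (curvature_at D x (p x) (q x) (\<xi> x)) (q x) = 0"
begin

section \<open>Consequences of the Ricci conditions\<close>

lemma ricci_derivs:
  assumes x: "x \<in> U"
  shows "dir_deriv \<xi> a x = 2 * \<alpha>\<^sub>0 x * a x" "dir_deriv \<xi> e x = - 2 * \<alpha>\<^sub>0 x * e x"
    "dir_deriv q a x = 2 * a x * \<alpha>\<^sub>2 x" "dir_deriv p e x = - 2 * e x * \<alpha>\<^sub>1 x"
  using ricci[OF x] curvature_frame(1-4)[OF x] by simp_all

text \<open>For differentiating the identities of \<open>ricci_derivs\<close> and
  \<open>cross_derivs\<close> once more; these hold on \<open>U\<close> only, so the equation for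
  \<open>f\<close> is assumed there and not for all arguments.\<close>

lemma dir_deriv_product:
  fixes f u v :: "real ^ 3 \<Rightarrow> real"
  assumes x: "x \<in> U" and f: "\<And>y. y \<in> U \<Longrightarrow> f y = c * u y * v y"
    and d: "u differentiable at x" "v differentiable at x"
  shows "dir_deriv X f x = c * (dir_deriv X u x * v x + u x * dir_deriv X v x)"
proof -
  have "dir_deriv X (\<lambda>y. c * (u y * v y)) x = c * (dir_deriv X u x * v x + u x * dir_deriv X v x)"
    using d by (simp add: dir_deriv_bounded_linear[OF bounded_linear_mult_right] dir_deriv_mult differentiable_mult)
  moreover have "dir_deriv X (\<lambda>y. c * (u y * v y)) x = dir_deriv X f x"
    by (rule dir_deriv_cong[OF U x]) (use d f in auto)
  ultimately show ?thesis by simp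
qed

lemma commutator:
  fixes f :: "real ^ 3 \<Rightarrow> real"
  assumes x: "x \<in> U" and f: "smooth_on U f"
  shows "dir_deriv \<xi> (dir_deriv p f) x - dir_deriv p (dir_deriv \<xi> f) x =
      (1 + \<alpha>\<^sub>0 x) * dir_deriv p f x + a x * dir_deriv q f x"
    and "dir_deriv \<xi> (dir_deriv q f) x - dir_deriv q (dir_deriv \<xi> f) x =
      e x * dir_deriv p f x - (1 + \<alpha>\<^sub>0 x) * dir_deriv q f x"
    and "dir_deriv p (dir_deriv q f) x - dir_deriv q (dir_deriv p f) x =
      2 * dir_deriv \<xi> f x - \<alpha>\<^sub>2 x * dir_deriv p f x - \<alpha>\<^sub>1 x * dir_deriv q f x"
proof -
  have l: "linear (frechet_derivative f (at x))"
    by (rule linear_frechet_derivative[OF smooth_on_differentiable[OF f x]])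
  show "dir_deriv \<xi> (dir_deriv p f) x - dir_deriv p (dir_deriv \<xi> f) x =
      (1 + \<alpha>\<^sub>0 x) * dir_deriv p f x + a x * dir_deriv q f x"
    "dir_deriv \<xi> (dir_deriv q f) x - dir_deriv q (dir_deriv \<xi> f) x =
      e x * dir_deriv p f x - (1 + \<alpha>\<^sub>0 x) * dir_deriv q f x"
    "dir_deriv p (dir_deriv q f) x - dir_deriv q (dir_deriv p f) x =
      2 * dir_deriv \<xi> f x - \<alpha>\<^sub>2 x * dir_deriv p f x - \<alpha>\<^sub>1 x * dir_deriv q f x"
    by (simp_all add: dir_deriv_commutator[OF U x] f dir_deriv_def[of "lie_bracket X Y" for X Y] brackets[OF x]
        linear_add[OF l] linear_diff[OF l] linear_cmul[OF l]) (simp_all add: dir_deriv_def)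
qed

text \<open>Applying \<open>[\<xi>,q]\<close> to \<open>a\<close> and \<open>[\<xi>,p]\<close> to \<open>e\<close>.\<close>

lemma cross_derivs:
  assumes x: "x \<in> U"
  shows "e x * dir_deriv p a x = 2 * a x * e x * \<alpha>\<^sub>1 x"
    and "a x * dir_deriv q e x = - 2 * a x * e x * \<alpha>\<^sub>2 x"
proof -
  have 1: "dir_deriv X (dir_deriv \<xi> a) x = 2 * (dir_deriv X \<alpha>\<^sub>0 x * a x + \<alpha>\<^sub>0 x * dir_deriv X a x)"
    "dir_deriv X (dir_deriv \<xi> e) x = - 2 * (dir_deriv X \<alpha>\<^sub>0 x * e x + \<alpha>\<^sub>0 x * dir_deriv X e x)"
    "dir_deriv X (dir_deriv q a) x = 2 * (dir_deriv X a x * \<alpha>\<^sub>2 x + a x * dir_deriv X \<alpha>\<^sub>2 x)"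
    "dir_deriv X (dir_deriv p e) x = - 2 * (dir_deriv X e x * \<alpha>\<^sub>1 x + e x * dir_deriv X \<alpha>\<^sub>1 x)" for X
    by (rule dir_deriv_product[OF x]; simp add: ricci_derivs x)+
  \<comment> \<open>The left side of the commutator is 2a (\<xi>(\<open>\<alpha>\<^sub>2\<close>) -
    q(\<open>\<alpha>\<^sub>0\<close>)). By \<open>jacobi\<close> and the known value of p(e) this
    is algebraic in the coefficients, and the terms with \<open>1 + \<alpha>\<^sub>0\<close> cancel
    against the right side. The factor \<open>e\<close> comes from the p-component of [\<xi>,q], so
    p(a) itself is not determined where \<open>e\<close> vanishes.\<close>
  show "e x * dir_deriv p a x = 2 * a x * e x * \<alpha>\<^sub>1 x"
    using commutator(2)[OF x, of a] by (auto simp: 1 ricci_derivs x jacobi algebra_simps)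
  show "a x * dir_deriv q e x = - 2 * a x * e x * \<alpha>\<^sub>2 x"
    using commutator(1)[OF x, of e] by (auto simp: 1 ricci_derivs x jacobi algebra_simps)
qed

text \<open>Along p the product rule gives e p(a) + a p(e), and the first summand is precisely what
  \<open>cross_derivs\<close> provides; likewise along q. So the zeros of \<open>a\<close> and
  \<open>e\<close> need no separate treatment.\<close>

lemma product_deriv_zero:
  assumes x: "x \<in> U"
  shows "((\<lambda>y. a y * e y) has_derivative (\<lambda>_. 0)) (at x)"
proof -
  have d: "(\<lambda>y. a y * e y) differentiable at x" using x by simp
  have z: "dir_deriv X (\<lambda>y. a y * e y) x = 0" if "X = \<xi> \<or> X = p \<or> X = q" for X
    using that cross_derivs[OF x] ricci_derivs[OF x] by (auto simp: dir_deriv_mult x algebra_simps)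
  have "frechet_derivative (\<lambda>y. a y * e y) (at x) v = 0" for v
    using z[of \<xi>] z[of p] z[of q] unfolding dir_deriv_def
    by (subst frame_expand[OF x, of v])
      (simp add: linear_add[OF linear_frechet_derivative[OF d]] linear_cmul[OF linear_frechet_derivative[OF d]])
  then show ?thesis
    using d unfolding frechet_derivative_works by (metis (no_types, lifting) ext)
qed

text \<open>No logarithm of \<open>a\<close> is formed: the commutator of p and q is applied to
  \<open>a\<close> itself. After cancelling \<open>a\<close> it gives the exterior derivative of the
  connection form on p, q, which removes all derivatives from the curvature formula.\<close>

lemma curvature_pq:
  assumes x: "x \<in> U" and ne: "a x * e x \<noteq> 0"
  shows "bilin (g x) (curvature_at D x (p x) (q x) (p x)) (q x) = 1 + a x * e x"
proof -
  have "e x * dir_deriv p a x = e x * (2 * a x * \<alpha>\<^sub>1 x)" "a x * dir_deriv q e x = a x * (- 2 * e x * \<alpha>\<^sub>2 x)"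
    using cross_derivs[OF x] by (auto simp: algebra_simps)
  then have pa: "dir_deriv p a x = 2 * a x * \<alpha>\<^sub>1 x" and qe: "dir_deriv q e x = - 2 * e x * \<alpha>\<^sub>2 x"
    using ne by (metis mult_left_cancel mult_zero_left mult_zero_right)+
  have pqa: "dir_deriv p (dir_deriv q a) x = 2 * (dir_deriv p a x * \<alpha>\<^sub>2 x + a x * dir_deriv p \<alpha>\<^sub>2 x)"
    by (rule dir_deriv_product[OF x]; simp add: ricci_derivs x)
  have sm: "smooth_on U (dir_deriv p a)" by (intro smooth_on_dir_deriv U) simp_all
  \<comment> \<open>The formula for p(a) without the factor \<open>e\<close> is known at
    \<open>x\<close> only and cannot be differentiated. The version multiplied by \<open>e\<close>
    holds on all of \<open>U\<close>, and on its right side the factor \<open>ae\<close> has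
    derivative 0.\<close>
  have "dir_deriv q (\<lambda>y. e y * dir_deriv p a y) x = dir_deriv q (\<lambda>y. 2 * (a y * e y) * \<alpha>\<^sub>1 y) x"
    using smooth_on_differentiable[OF sm x] x
    by (intro dir_deriv_cong[OF U x]) (auto simp: cross_derivs)
  also have "\<dots> = 2 * (dir_deriv q (\<lambda>y. a y * e y) x * \<alpha>\<^sub>1 x + (a x * e x) * dir_deriv q \<alpha>\<^sub>1 x)"
    using x by (intro dir_deriv_product[OF x]) auto
  also have "dir_deriv q (\<lambda>y. a y * e y) x = 0"
    using dir_deriv_eq[OF product_deriv_zero[OF x]] .
  finally have "e x * dir_deriv q (dir_deriv p a) x = 2 * (a x * e x) * dir_deriv q \<alpha>\<^sub>1 x - dir_deriv q e x * dir_deriv p a x"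
    using smooth_on_differentiable[OF sm x] x by (simp add: dir_deriv_mult algebra_simps)
  then have "e x * dir_deriv q (dir_deriv p a) x = e x * (2 * a x * dir_deriv q \<alpha>\<^sub>1 x + 4 * a x * \<alpha>\<^sub>1 x * \<alpha>\<^sub>2 x)"
    by (simp add: pa qe algebra_simps)
  then have "dir_deriv q (dir_deriv p a) x = 2 * a x * dir_deriv q \<alpha>\<^sub>1 x + 4 * a x * \<alpha>\<^sub>1 x * \<alpha>\<^sub>2 x"
    using ne by simp
  with commutator(3)[OF x, of a]
  have "a x * (dir_deriv p \<alpha>\<^sub>2 x - dir_deriv q \<alpha>\<^sub>1 x) = a x * (2 * \<alpha>\<^sub>0 x - 2 * \<alpha>\<^sub>1 x * \<alpha>\<^sub>2 x)"
    by (simp add: pqa pa ricci_derivs x algebra_simps)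
  then have "dir_deriv p \<alpha>\<^sub>2 x - dir_deriv q \<alpha>\<^sub>1 x = 2 * \<alpha>\<^sub>0 x - 2 * \<alpha>\<^sub>1 x * \<alpha>\<^sub>2 x"
    using ne by simp
  then show ?thesis by (simp add: curvature_frame(9)[OF x])
qed

end

section \<open>Paracontact structures in a chart\<close>

lemma curvature_at_antisym:
  assumes "affine_connection_on S D" "x \<in> S"
  shows "curvature_at D x u v w = - curvature_at D x v u w"
  by (simp add: curvature_at_eq[OF assms])

lemma matrix_vector_mult_neg: "A *v (- v) = - (A *v v)" for A :: "real ^ 'n ^ 'm"
  by (rule linear_neg[OF matrix_vector_mul_linear])

text \<open>The derivatives of \<open>X\<close> in the two brackets cancel, so the right side
  depends on \<open>X\<close> through its value at \<open>x\<close> alone.\<close>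

lemma lie_deriv_endo_eq:
  assumes "T differentiable at x" "V differentiable at x" "X differentiable at x"
  shows "lie_deriv_endo V T X x = dir_deriv V T x *v X x
    - frechet_derivative V (at x) (T x *v X x) + T x *v frechet_derivative V (at x) (X x)"
  using assms
  by (simp add: lie_deriv_endo_def lie_bracket_def dir_deriv_matrix_vector_mult
      matrix_vector_mult_diff_distrib) (simp add: dir_deriv_def)

text \<open>\<open>h_tensor\<close> is defined by constant extensions; tensoriality allows it to be
  evaluated on the frame fields, whose brackets are known.\<close>

lemma h_tensor_apply:
  assumes "T differentiable at x" "V differentiable at x" "X differentiable at x"
  shows "h_tensor T V x *v X x = (1/2) *\<^sub>R lie_deriv_endo V T X x"
proof -
  have l: "linear (frechet_derivative V (at x))"
    using assms by (simp add: linear_frechet_derivative)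
  have c: "lie_deriv_endo V T (\<lambda>_. v) x = dir_deriv V T x *v v
      - frechet_derivative V (at x) (T x *v v) + T x *v frechet_derivative V (at x) v" for v
    using assms by (simp add: lie_deriv_endo_eq)
  have "linear (\<lambda>v. lie_deriv_endo V T (\<lambda>_. v) x)"
    unfolding c
    by (intro linearI) (simp_all add: matrix_vector_right_distrib matrix_vector_mult_scaleR
        linear_add[OF l] linear_cmul[OF l] scaleR_diff_right scaleR_add_right)
  then show ?thesis
    using assms by (simp add: h_tensor_def endo_at_def scaleR_matrix_vector_assoc[symmetric] c
        lie_deriv_endo_eq)
qed

text \<open>The curvature of a null frame can be computed from the metric and the brackets; \<phi>
  is added here through its eigenvalues 0, 1, -1 on the frame.\<close>

locale adapted_null_frame = null_frame +
  fixes \<phi> :: "real ^ 3 \<Rightarrow> real ^ 3 ^ 3"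
  assumes smooth_phi: "smooth_on U \<phi>"
    and phi_frame: "x \<in> U \<Longrightarrow> \<phi> x *v \<xi> x = 0" "x \<in> U \<Longrightarrow> \<phi> x *v p x = p x"
      "x \<in> U \<Longrightarrow> \<phi> x *v q x = - q x"
begin

lemma phi_expand:
  assumes x: "x \<in> U"
  shows "\<phi> x *v u = bilin (g x) u (q x) *\<^sub>R p x - bilin (g x) u (p x) *\<^sub>R q x"
  by (subst frame_expand[OF x, of u]) (simp add: matrix_vector_right_distrib matrix_vector_mult_scaleR phi_frame x)

lemma h_frame:
  assumes x: "x \<in> U"
  shows "h_tensor \<phi> \<xi> x *v \<xi> x = 0" "h_tensor \<phi> \<xi> x *v p x = a x *\<^sub>R q x"
    "h_tensor \<phi> \<xi> x *v q x = - e x *\<^sub>R p x"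
proof -
  note h = h_tensor_apply[OF smooth_on_differentiable[OF smooth_phi x] differentiable_frame(1)[OF x]]
  have c: "lie_bracket \<xi> (\<lambda>y. \<phi> y *v X y) x = lie_bracket \<xi> Y x"
    if "smooth_on U X" "\<And>y. y \<in> U \<Longrightarrow> \<phi> y *v X y = Y y" for X Y
    by (rule lie_bracket_cong_right[OF U x]) (use that x U smooth_phi in
        \<open>auto intro!: smooth_on_differentiable smooth_on_matrix_vector_mult\<close>)
  have z: "lie_bracket \<xi> (\<lambda>y. 0) x = 0"
    using x by (simp add: lie_bracket_def dir_deriv_def linear_frechet_derivative linear_0)
  have m: "lie_bracket \<xi> (\<lambda>y. - q y) x = - lie_bracket \<xi> q x"
    using lie_bracket_scaleR_right[of \<xi> x q "\<lambda>_. -1"] x by simp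
  show "h_tensor \<phi> \<xi> x *v \<xi> x = 0"
    using h[of \<xi>] c[of \<xi> "\<lambda>_. 0"] x by (simp add: lie_deriv_endo_def phi_frame z)
  \<comment> \<open>Since p is fixed by \<phi>, the operator 1 - \<phi> acts on the bracket
    [\<xi>,p] and doubles its q-part while killing its p-part.\<close>
  have "h_tensor \<phi> \<xi> x *v p x = (1/2) *\<^sub>R (lie_bracket \<xi> p x - \<phi> x *v lie_bracket \<xi> p x)"
    using h[of p] c[of p p] x by (simp add: lie_deriv_endo_def phi_frame)
  then show "h_tensor \<phi> \<xi> x *v p x = a x *\<^sub>R q x"
    using x by (simp add: phi_frame brackets matrix_vector_right_distrib matrix_vector_mult_scaleR
        vec_eq_iff field_simps)
  have "h_tensor \<phi> \<xi> x *v q x = (1/2) *\<^sub>R (- lie_bracket \<xi> q x - \<phi> x *v lie_bracket \<xi> q x)"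
    using h[of q] c[of q "\<lambda>y. - q y"] x by (simp add: lie_deriv_endo_def phi_frame m)
  then show "h_tensor \<phi> \<xi> x *v q x = - e x *\<^sub>R p x"
    using x by (simp add: phi_frame brackets matrix_vector_mult_diff_distrib matrix_vector_mult_scaleR
        matrix_vector_right_distrib vec_eq_iff field_simps)
qed

lemma trace_h_square:
  assumes x: "x \<in> U"
  shows "trace (h_tensor \<phi> \<xi> x ** h_tensor \<phi> \<xi> x) = - 2 * (a x * e x)"
proof -
  let ?h = "h_tensor \<phi> \<xi> x"
  have "trace (?h ** ?h) = trace (matrix (\<lambda>v. ?h *v (?h *v v)))"
    by (simp add: matrix_vector_mul_assoc)
  also have "\<dots> = - 2 * (a x * e x)"
    by (subst frame_trace[OF x])
      (auto simp: matrix_vector_mul_assoc[symmetric] h_frame x matrix_vector_mult_scaleR bilin_linear gram gram'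
        matrix_vector_right_distrib matrix_vector_mult_neg intro!: linearI)
  finally show ?thesis .
qed

text \<open>\<open>ricci_operator\<close> is a definite description, so existence and uniqueness
  must be shown before it can be used. Existence needs the linearity of the Ricci form in both
  arguments, uniqueness the nondegeneracy of the frame's Gram matrix.\<close>

lemma ricci_operator:
  assumes x: "x \<in> U"
  shows "bilin (g x) (ricci_operator g D x *v v) w = trace (matrix (\<lambda>u. curvature_at D x u v w))"
proof -
  define Ric where "Ric v w = trace (matrix (\<lambda>u. curvature_at D x u v w))" for v w
  note lin = curvature_at_linear[OF affine U x]
  have Ric: "Ric v w = bilin (g x) (curvature_at D x (\<xi> x) v w) (\<xi> x)
      + bilin (g x) (curvature_at D x (p x) v w) (q x) + bilin (g x) (curvature_at D x (q x) v w) (p x)" for v w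
    unfolding Ric_def by (rule frame_trace[OF x lin(1)])
  have l1: "linear (\<lambda>v. Ric v w)" for w
    by (intro linearI) (simp_all add: Ric linear_add[OF lin(2)] linear_cmul[OF lin(2)] bilin_linear algebra_simps)
  have l2: "linear (Ric v)" for v
    by (intro linearI) (simp_all add: Ric linear_add[OF lin(3)] linear_cmul[OF lin(3)] bilin_linear algebra_simps)
  \<comment> \<open>The second index of the Ricci form is raised with the dual basis \<xi>, q,
    p.\<close>
  define Q where "Q = matrix (\<lambda>v. Ric v (\<xi> x) *\<^sub>R \<xi> x + Ric v (p x) *\<^sub>R q x + Ric v (q x) *\<^sub>R p x)"
  have "linear (\<lambda>v. Ric v (\<xi> x) *\<^sub>R \<xi> x + Ric v (p x) *\<^sub>R q x + Ric v (q x) *\<^sub>R p x)"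
    by (intro linearI) (simp_all add: linear_add[OF l1] linear_cmul[OF l1] algebra_simps)
  then have Qv: "Q *v v = Ric v (\<xi> x) *\<^sub>R \<xi> x + Ric v (p x) *\<^sub>R q x + Ric v (q x) *\<^sub>R p x" for v
    by (simp add: Q_def)
  have Q: "bilin (g x) (Q *v v) w = Ric v w" for v w
    by (subst (2) frame_expand[OF x, of w])
      (simp add: Qv linear_add[OF l2] linear_cmul[OF l2] bilin_linear g_sym[OF x, of _ w] algebra_simps)
  have "\<exists>!Q. \<forall>v w. bilin (g x) (Q *v v) w = Ric v w"
  proof (rule ex1I[of _ Q])
    fix Q' assume Q': "\<forall>v w. bilin (g x) (Q' *v v) w = Ric v w"
    show "Q' = Q"
      by (rule matrix_eq[THEN iffD2]) (auto intro!: frame_eqI[OF x] simp: Q Q')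
  qed (simp add: Q)
  from theI'[OF this] show ?thesis
    by (simp add: ricci_operator_def Ric_def)
qed

text \<open>As Q commutes with \<phi>, the vector Qp is again fixed by \<phi> and hence a multiple
  of p, so it is orthogonal to \<xi> and p; likewise Qq is orthogonal to \<xi> and q. In each of the
  four Ricci components only one of the three trace terms can be nonzero.\<close>

lemma commuting_null_frame:
  assumes comm: "\<And>x. x \<in> U \<Longrightarrow> ricci_operator g D x ** \<phi> x = \<phi> x ** ricci_operator g D x"
  shows "commuting_null_frame U g D \<xi> p q"
proof unfold_locales
  fix x assume x: "x \<in> U"
  let ?Q = "ricci_operator g D x"
  have c: "\<phi> x *v (?Q *v v) = ?Q *v (\<phi> x *v v)" for v
    using comm[OF x] by (simp add: matrix_vector_mul_assoc)
  note s = curvature_at_antisym[OF affine x]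
  have z: "curvature_at D x u u w = 0" for u w
    by (simp add: curvature_at_eq[OF affine x])
  have [simp]: "bilin (g x) (curvature_at D x (\<xi> x) (p x) (\<xi> x)) (\<xi> x) = 0"
    "bilin (g x) (curvature_at D x (\<xi> x) (q x) (\<xi> x)) (\<xi> x) = 0"
    by (simp_all add: curvature_cov cov_bracket x frame_cov contact_cov(1,2) dir_deriv_frame_cov)
  have tr: "bilin (g x) (?Q *v v) w = bilin (g x) (curvature_at D x (\<xi> x) v w) (\<xi> x)
      + bilin (g x) (curvature_at D x (p x) v w) (q x) + bilin (g x) (curvature_at D x (q x) v w) (p x)" for v w
    unfolding ricci_operator[OF x] by (rule frame_trace[OF x curvature_at_linear(1)[OF affine U x]])
  have "bilin (g x) (?Q *v p x) (\<xi> x) = 0" "bilin (g x) (?Q *v p x) (p x) = 0"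
    using arg_cong[OF c[of "p x"], of "\<lambda>v. bilin (g x) v (\<xi> x)"]
      arg_cong[OF c[of "p x"], of "\<lambda>v. bilin (g x) v (p x)"]
    unfolding phi_expand[OF x, of "?Q *v v" for v] by (simp_all add: phi_frame x bilin_linear gram gram')
  moreover have "bilin (g x) (?Q *v q x) (\<xi> x) = 0" "bilin (g x) (?Q *v q x) (q x) = 0"
    using arg_cong[OF c[of "q x"], of "\<lambda>v. bilin (g x) v (\<xi> x)"]
      arg_cong[OF c[of "q x"], of "\<lambda>v. bilin (g x) v (q x)"]
    unfolding phi_expand[OF x, of "?Q *v v" for v]
    by (simp_all add: phi_frame x bilin_linear gram gram' matrix_vector_mult_neg)
  ultimately show "bilin (g x) (curvature_at D x (\<xi> x) (p x) (p x)) (\<xi> x) = 0"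
    "bilin (g x) (curvature_at D x (\<xi> x) (q x) (q x)) (\<xi> x) = 0"
    "bilin (g x) (curvature_at D x (q x) (p x) (\<xi> x)) (p x) = 0"
    "bilin (g x) (curvature_at D x (p x) (q x) (\<xi> x)) (q x) = 0"
    using curvature_frame(11,12)[OF x] by (simp_all add: tr z s[of "q x" "p x" "p x"] bilin_linear)
qed

text \<open>Write X = s p + t q, so \<phi>X = s p - t q and g(X,X) = 2st. Both curvatures come out
  as (2st)^2 times an expression free of X, and (2st)^2 = 1 whatever the sign of g(X,X). The mixed
  terms vanish by the Ricci conditions and by items 11 and 12 of
  \<open>curvature_frame\<close>.\<close>

lemma sectional_curvatures:
  assumes comm: "\<And>x. x \<in> U \<Longrightarrow> ricci_operator g D x ** \<phi> x = \<phi> x ** ricci_operator g D x"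
    and x: "x \<in> U" and ne: "a x * e x \<noteq> 0"
    and X: "bilin (g x) X (\<xi> x) = 0" "bilin (g x) X X = 1 \<or> bilin (g x) X X = -1"
  shows "xi_sectional_curvature g D \<xi> x X = - (a x * e x) - 1"
    and "phi_sectional_curvature g D \<phi> x X = a x * e x + 1"
proof -
  interpret commuting_null_frame U g D \<xi> p q
    by (rule commuting_null_frame[OF comm])
  define s t where "s = bilin (g x) X (q x)" and "t = bilin (g x) X (p x)"
  have Xe: "X = s *\<^sub>R p x + t *\<^sub>R q x"
    using frame_expand[OF x, of X] X(1) by (simp add: s_def t_def)
  have XX: "bilin (g x) X X = 2 * s * t"
    unfolding Xe by (simp add: bilin_linear gram gram' x algebra_simps)
  have st: "(2 * s * t)\<^sup>2 = 1"
    using X(2) XX by auto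
  have phX: "\<phi> x *v X = s *\<^sub>R p x - t *\<^sub>R q x"
    unfolding phi_expand[OF x] s_def t_def ..
  note lin = curvature_at_linear[OF affine U x]
  note lins = lin[THEN linear_add] lin[THEN linear_diff] lin[THEN linear_cmul]
  have "bilin (g x) (curvature_at D x X (\<xi> x) (\<xi> x)) X = (2 * s * t) * (- (a x * e x) - 1)"
    unfolding Xe
    by (simp add: lins bilin_linear curvature_frame(5-8)[OF x] ricci_derivs[OF x] algebra_simps)
  then have "xi_sectional_curvature g D \<xi> x X = (2 * s * t)\<^sup>2 * (- (a x * e x) - 1)"
    by (simp only: xi_sectional_curvature_def curvature4_def XX power2_eq_square mult.assoc)
  then show "xi_sectional_curvature g D \<xi> x X = - (a x * e x) - 1"
    using st by simp
  note sy = curvature_at_antisym[OF affine x]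
  have z: "curvature_at D x u u w = 0" for u w
    by (simp add: curvature_at_eq[OF affine x])
  have qp: "bilin (g x) (curvature_at D x (p x) (q x) (q x)) (p x) = - (1 + a x * e x)"
    using curvature_frame(9,10)[OF x] curvature_pq[OF x ne] by simp
  have "curvature_at D x X (\<phi> x *v X) w = - (2 * s * t) *\<^sub>R curvature_at D x (p x) (q x) w" for w
    unfolding phX unfolding Xe
    by (simp add: lins z sy[of "q x" "p x" w] vec_eq_iff algebra_simps)
  moreover have "bilin (g x) (curvature_at D x (p x) (q x) (\<phi> x *v X)) X = (2 * s * t) * (1 + a x * e x)"
    unfolding phX unfolding Xe
    by (simp add: lins bilin_linear curvature_frame(11,12)[OF x] curvature_pq[OF x ne] qp algebra_simps)
  ultimately have "bilin (g x) (curvature_at D x X (\<phi> x *v X) (\<phi> x *v X)) X = - (2 * s * t)\<^sup>2 * (1 + a x * e x)"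
    by (simp add: bilin_linear power2_eq_square)
  then show "phi_sectional_curvature g D \<phi> x X = a x * e x + 1"
    unfolding st by (simp add: phi_sectional_curvature_def curvature4_def)
qed

end

section \<open>Restriction of the Levi-Civita connection to an open subset\<close>

text \<open>Constant fields are smooth on all of \<open>S\<close>; for them the axioms give the
  symmetry of the Christoffel symbols and their relation to the derivative of \<open>g\<close>.
  These two pointwise facts imply the axioms for all fields on \<open>U\<close>.\<close>

lemma levi_civita_on_local_connection:
  fixes D :: "'n::finite connection"
  assumes LC: "levi_civita_on S g D" and S: "open S" and U: "open U" "U \<subseteq> S"
    and g: "smooth_on S g"
  shows "levi_civita_on U g (local_connection D)"
proof -
  have D: "affine_connection_on S D" using LC by (simp add: levi_civita_on_def)
  have sym: "D (\<lambda>_. u) (\<lambda>_. v) x = D (\<lambda>_. v) (\<lambda>_. u) x" if "x \<in> S" for u v x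
  proof -
    have "D (\<lambda>_. u) (\<lambda>_. v) x - D (\<lambda>_. v) (\<lambda>_. u) x = lie_bracket (\<lambda>_. u) (\<lambda>_. v) x"
      using LC that smooth_on_const unfolding levi_civita_on_def by blast
    then show ?thesis by simp
  qed
  have gc: "dir_deriv (\<lambda>_. u) (\<lambda>y. bilin (g y) v w) x =
      bilin (g x) (D (\<lambda>_. u) (\<lambda>_. v) x) w + bilin (g x) v (D (\<lambda>_. u) (\<lambda>_. w) x)" if "x \<in> S" for u v w x
    using LC that smooth_on_const[of S u] smooth_on_const[of S v] smooth_on_const[of S w]
    unfolding levi_civita_on_def by blast
  have gU: "smooth_on U g" using g U smooth_on_subset by blast
  show ?thesis
    unfolding levi_civita_on_def
  proof (intro conjI allI impI ballI affine_connection_on_local_connection[OF D U])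
    fix X Y :: "real ^ 'n \<Rightarrow> real ^ 'n" and x assume "smooth_on U X" "smooth_on U Y" "x \<in> U"
    then show "local_connection D X Y x - local_connection D Y X x = lie_bracket X Y x"
      using sym U by (auto simp: local_connection_def lie_bracket_def)
  next
    fix X Y Z :: "real ^ 'n \<Rightarrow> real ^ 'n" and x assume X: "smooth_on U X" and Y: "smooth_on U Y" and Z: "smooth_on U Z" and x: "x \<in> U"
    have l: "linear (\<lambda>u. bilin (g y) u w)" "linear (bilin (g y) w)" for y w
      by (auto intro!: linearI simp: bilin_linear)
    have "dir_deriv X (\<lambda>y. bilin (g y) (Y y) (Z y)) x =
        dir_deriv X (\<lambda>y. bilin (g y) (Y y) (Z x)) x + bilin (g x) (Y x) (dir_deriv X Z x)"
      by (rule dir_deriv_linear_family[OF U(1) x Z]) (intro l smooth_on_bilin U gU Y smooth_on_const)+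
    also have "dir_deriv X (\<lambda>y. bilin (g y) (Y y) (Z x)) x =
        dir_deriv X (\<lambda>y. bilin (g y) (Y x) (Z x)) x + bilin (g x) (dir_deriv X Y x) (Z x)"
      by (rule dir_deriv_linear_family[OF U(1) x Y, of "\<lambda>y u. bilin (g y) u (Z x)"])
        (intro l smooth_on_bilin U gU smooth_on_const)+
    also have "dir_deriv X (\<lambda>y. bilin (g y) (Y x) (Z x)) x = dir_deriv (\<lambda>_. X x) (\<lambda>y. bilin (g y) (Y x) (Z x)) x"
      by (simp add: dir_deriv_def)
    finally show "dir_deriv X (\<lambda>y. bilin (g y) (Y y) (Z y)) x =
        bilin (g x) (local_connection D X Y x) (Z x) + bilin (g x) (Y x) (local_connection D X Z x)"
      using U x gc by (auto simp: local_connection_def bilin_linear)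
  qed
qed

lemma ricci_operator_local_connection:
  assumes D: "affine_connection_on S D" and S: "open S" and U: "open U" "U \<subseteq> S" "x \<in> U"
  shows "ricci_operator g (local_connection D) x = ricci_operator g D x"
  by (simp add: ricci_operator_def curvature_at_local_connection[OF assms])

section \<open>Construction of adapted null frames in a chart\<close>

text \<open>The tensorial equations of the structure are kept for constant vectors only;
  \<open>ext_deriv_tensorial\<close> recovers them for fields.\<close>

locale paracontact_chart =
  fixes S :: "(real ^ 3) set" and \<phi> g :: "real ^ 3 \<Rightarrow> real ^ 3 ^ 3" and \<xi> \<eta> :: "real ^ 3 \<Rightarrow> real ^ 3"
    and D :: "3 connection"
  assumes S: "open S"
    and smooth: "smooth_on S \<phi>" "smooth_on S g" "smooth_on S \<xi>" "smooth_on S \<eta>"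
    and g_sym: "x \<in> S \<Longrightarrow> bilin (g x) u v = bilin (g x) v u"
    and g_nondegenerate: "x \<in> S \<Longrightarrow> (\<And>w. bilin (g x) v w = 0) \<Longrightarrow> v = 0"
    and eta_xi: "x \<in> S \<Longrightarrow> \<eta> x \<bullet> \<xi> x = 1"
    and d_eta_xi: "x \<in> S \<Longrightarrow> ext_deriv \<eta> \<xi> (\<lambda>_. v) x = 0"
    and d_eta: "x \<in> S \<Longrightarrow> ext_deriv \<eta> (\<lambda>_. u) (\<lambda>_. v) x = bilin (g x) u (\<phi> x *v v)"
    and eta: "x \<in> S \<Longrightarrow> \<eta> x \<bullet> u = bilin (g x) u (\<xi> x)"
    and phi_square: "x \<in> S \<Longrightarrow> \<phi> x *v (\<phi> x *v u) = u - (\<eta> x \<bullet> u) *\<^sub>R \<xi> x"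
    and LC: "levi_civita_on S g D"
    and commute: "x \<in> S \<Longrightarrow> ricci_operator g D x ** \<phi> x = \<phi> x ** ricci_operator g D x"
begin

lemma phi_skew: "x \<in> S \<Longrightarrow> bilin (g x) u (\<phi> x *v v) = - bilin (g x) v (\<phi> x *v u)"
  using d_eta ext_deriv_antisym by metis

lemma g_xi_phi: assumes x: "x \<in> S"
  shows "bilin (g x) (\<xi> x) (\<phi> x *v v) = 0" "bilin (g x) (\<phi> x *v v) (\<xi> x) = 0"
proof -
  show "bilin (g x) (\<xi> x) (\<phi> x *v v) = 0"
    using d_eta[OF x, of "\<xi> x" v] d_eta_xi[OF x, of v] ext_deriv_tensorial[of \<eta> x \<xi> "\<lambda>_. v"]
      smooth(3,4)[THEN smooth_on_differentiable, OF x] by simp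
  then show "bilin (g x) (\<phi> x *v v) (\<xi> x) = 0" using g_sym[OF x] by simp
qed

lemma phi_xi: "x \<in> S \<Longrightarrow> \<phi> x *v \<xi> x = 0"
  by (rule g_nondegenerate) (auto simp: g_sym[of x "\<phi> x *v \<xi> x"] phi_skew[of x _ "\<xi> x"] g_xi_phi)

lemma phi_cube: "x \<in> S \<Longrightarrow> \<phi> x *v (\<phi> x *v (\<phi> x *v u)) = \<phi> x *v u"
  using phi_square[of x "\<phi> x *v u"] by (simp add: eta g_xi_phi)

text \<open>Otherwise \<phi> would be -1 on the complement of \<xi>. There g(u,\<phi>w) is skew
  while g(u,w) is symmetric, so \<open>g\<close> would vanish on the complement; by nondegeneracy
  the complement would be 0 and the space spanned by \<xi>.\<close>

lemma eigenvector_exists: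
  assumes x: "x \<in> S"
  shows "\<exists>v. \<phi> x *v (\<phi> x *v v) + \<phi> x *v v \<noteq> 0"
proof (rule ccontr)
  assume "\<not> ?thesis"
  then have neg: "\<phi> x *v (\<phi> x *v v) = - (\<phi> x *v v)" for v
    by (simp add: eq_neg_iff_add_eq_0)
  have u: "u = - (\<phi> x *v u)" if "bilin (g x) u (\<xi> x) = 0" for u
    using neg[of u] phi_square[OF x, of u] that by (simp add: eta[OF x])
  have 0: "u = 0" if *: "bilin (g x) u (\<xi> x) = 0" for u
  proof (rule g_nondegenerate[OF x])
    fix w
    define w' where "w' = w - bilin (g x) w (\<xi> x) *\<^sub>R \<xi> x"
    have w': "bilin (g x) w' (\<xi> x) = 0"
      using eta_xi[OF x] by (simp add: w'_def bilin_linear flip: eta[OF x])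
    have "bilin (g x) u w = bilin (g x) u w'"
      using * by (simp add: w'_def bilin_linear)
    also have "\<dots> = - bilin (g x) u (\<phi> x *v w')"
      using u[OF w'] by (metis bilin_minus_right)
    also have "\<dots> = bilin (g x) w' (\<phi> x *v u)" using phi_skew[OF x, of u w'] by simp
    also have "\<dots> = - bilin (g x) w' u" using u[OF *] by (metis bilin_minus_right minus_minus)
    finally have "bilin (g x) u w = - bilin (g x) w' u" .
    moreover have "bilin (g x) u w = bilin (g x) w' u"
      using * g_sym[OF x] by (simp add: w'_def bilin_linear)
    ultimately show "bilin (g x) u w = 0" by simp
  qed
  have "w \<in> span {\<xi> x}" for w
  proof -
    have "w - bilin (g x) w (\<xi> x) *\<^sub>R \<xi> x = 0"
      by (rule 0) (use eta_xi[OF x] in \<open>simp add: bilin_linear flip: eta[OF x]\<close>)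
    then show ?thesis by (auto simp: span_singleton)
  qed
  then have "dim (UNIV :: (real ^ 3) set) \<le> card {\<xi> x}"
    by (intro dim_le_card) auto
  then show False by simp
qed

text \<open>Since \<phi>^3 = \<phi>, the operators \<phi>^2 + \<phi> and \<phi>^2 - \<phi> map into
  the eigenspaces of 1 and -1. Applied to constant vectors \<open>v\<close> and \<open>w\<close>
  they give smooth fields on the whole chart; only the normalisation g(p,q) = 1 forces a smaller
  open set.\<close>

lemma null_frame_exists:
  assumes x: "x \<in> S"
  shows "\<exists>U p q. x \<in> U \<and> U \<subseteq> S \<and> adapted_null_frame U g (local_connection D) \<xi> p q \<phi>"
proof -
  obtain v where v: "\<phi> x *v (\<phi> x *v v) + \<phi> x *v v \<noteq> 0"
    using eigenvector_exists[OF x] by blast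
  define p where "p y = \<phi> y *v (\<phi> y *v v) + \<phi> y *v v" for y
  obtain w where w: "bilin (g x) (p x) w \<noteq> 0"
    using g_nondegenerate[OF x, of "p x"] v by (auto simp: p_def)
  define r where "r y = \<phi> y *v (\<phi> y *v w) - \<phi> y *v w" for y
  define \<sigma> where "\<sigma> y = bilin (g y) (p y) (r y)" for y
  define U where "U = {y \<in> S. \<sigma> y \<noteq> 0}"
  define q where "q y = inverse (\<sigma> y) *\<^sub>R r y" for y
  have sp: "smooth_on S p" unfolding p_def[abs_def]
    by (intro smooth_on_add smooth_on_matrix_vector_mult smooth S smooth_on_const)
  have sr: "smooth_on S r" unfolding r_def[abs_def]
    by (intro smooth_on_diff smooth_on_matrix_vector_mult smooth S smooth_on_const)
  have s\<sigma>: "smooth_on S \<sigma>" unfolding \<sigma>_def[abs_def] by (intro smooth_on_bilin S smooth sp sr)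
  have "U = S \<inter> \<sigma> -` (- {0})" by (auto simp: U_def)
  then have oU: "open U"
    using continuous_open_preimage[OF smooth_on_continuous_on[OF s\<sigma>] S, of "- {0}"] by (simp add: open_Compl)
  have US: "U \<subseteq> S" by (auto simp: U_def)
  have sU: "smooth_on U f" if "smooth_on S f" for f :: "real ^ 3 \<Rightarrow> 'z::real_normed_vector"
    using that US smooth_on_subset by blast
  have sq: "smooth_on U q" unfolding q_def[abs_def]
    by (intro smooth_on_scaleR smooth_on_inverse oU sU sr s\<sigma>) (auto simp: U_def)
  have pp: "\<phi> y *v p y = p y" and rr: "\<phi> y *v r y = - r y" if "y \<in> S" for y
    using phi_cube[OF that]
    by (simp_all add: p_def r_def matrix_vector_right_distrib matrix_vector_mult_diff_distrib)
  have qq: "\<phi> y *v q y = - q y" if "y \<in> S" for y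
    using rr[OF that] by (simp add: q_def matrix_vector_mult_scaleR)
  have xU: "x \<in> U"
  proof -
    \<comment> \<open>Skewness of \<phi> and \<phi> p = p give g(p,\<phi>z) = -g(p,z). Both terms of
      \<open>r\<close> then contribute g(p,w) to \<sigma>, which is therefore nonzero at
      \<open>x\<close>.\<close>
    have s: "bilin (g x) (p x) (\<phi> x *v z) = - bilin (g x) (p x) z" for z
      using phi_skew[OF x, of "p x" z] pp[OF x] g_sym[OF x] by simp
    have "\<sigma> x = 2 * bilin (g x) (p x) w"
      by (simp add: \<sigma>_def r_def bilin_linear s)
    then show ?thesis using w x by (simp add: U_def)
  qed
  have gxi: "bilin (g y) (\<xi> y) (p y) = 0" "bilin (g y) (\<xi> y) (q y) = 0"
    "bilin (g y) (p y) (\<xi> y) = 0" "bilin (g y) (q y) (\<xi> y) = 0" if "y \<in> S" for y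
    using g_xi_phi[OF that, of "p y"] g_xi_phi[OF that, of "q y"] pp[OF that] qq[OF that]
    by (simp_all add: bilin_linear)
  have pq: "bilin (g y) (p y) (q y) = 1" if "y \<in> U" for y
    using that by (simp add: q_def bilin_linear U_def \<sigma>_def)
  \<comment> \<open>When \<eta>(X) and \<eta>(Y) are constant, d\<eta>(X,Y) is -\<eta>([X,Y])/2; the
    factor -2 undoes this normalisation. It yields all three \<open>contact\<close>
    conditions.\<close>
  have br: "bilin (g y) (lie_bracket X Y y) (\<xi> y) = - 2 * bilin (g y) (X y) (\<phi> y *v Y y)"
    if y: "y \<in> U" and X: "smooth_on U X" and Y: "smooth_on U Y"
      and cX: "\<And>z. z \<in> U \<Longrightarrow> bilin (g z) (X z) (\<xi> z) = c" and cY: "\<And>z. z \<in> U \<Longrightarrow> bilin (g z) (Y z) (\<xi> z) = d"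
    for X Y y c d
  proof -
    have yS: "y \<in> S" using y US by auto
    have "ext_deriv \<eta> X Y y = bilin (g y) (X y) (\<phi> y *v Y y)"
      using ext_deriv_tensorial[of \<eta> y X Y] d_eta[OF yS] smooth_on_differentiable[OF X y]
        smooth_on_differentiable[OF Y y] smooth_on_differentiable[OF smooth(4) yS] by simp
    moreover have "dir_deriv V (\<lambda>z. \<eta> z \<bullet> W z) y = 0"
      if cW: "\<And>z. z \<in> U \<Longrightarrow> bilin (g z) (W z) (\<xi> z) = c'" for V W c'
      using dir_deriv_cong[OF oU y, of "\<lambda>_. c'" "\<lambda>z. \<eta> z \<bullet> W z" V] cW US by (auto simp: eta subset_iff)
    ultimately show ?thesis
      using cX cY by (simp add: ext_deriv_def eta[OF yS])
  qed
  have adapted: "adapted_null_frame U g (local_connection D) \<xi> p q \<phi>"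
  proof unfold_locales
    show "open U" "smooth_on U g" "smooth_on U \<xi>" "smooth_on U p" "smooth_on U q" "smooth_on U \<phi>"
      using oU sU smooth sp sq by auto
    show "levi_civita_on U g (local_connection D)"
      by (rule levi_civita_on_local_connection[OF LC S oU US smooth(2)])
  next
    fix y assume y: "y \<in> U"
    then have yS: "y \<in> S" using US by auto
    show "bilin (g y) u v = bilin (g y) v u" for u v using g_sym[OF yS] .
    show xx: "bilin (g y) (\<xi> y) (\<xi> y) = 1" using eta_xi[OF yS] eta[OF yS] by simp
    show "bilin (g y) (p y) (q y) = 1" using pq[OF y] .
    show "bilin (g y) (p y) (p y) = 0" "bilin (g y) (q y) (q y) = 0"
      using phi_skew[OF yS, of "p y" "p y"] phi_skew[OF yS, of "q y" "q y"] pp[OF yS] qq[OF yS]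
      by (simp_all add: bilin_linear)
    show "bilin (g y) (\<xi> y) (p y) = 0" "bilin (g y) (\<xi> y) (q y) = 0"
      using gxi[OF yS] by auto
    have xiU: "\<And>z. z \<in> U \<Longrightarrow> bilin (g z) (\<xi> z) (\<xi> z) = 1"
      using US eta_xi eta by (metis subsetD)
    have pU: "\<And>z. z \<in> U \<Longrightarrow> bilin (g z) (p z) (\<xi> z) = 0" "\<And>z. z \<in> U \<Longrightarrow> bilin (g z) (q z) (\<xi> z) = 0"
      using US gxi by auto
    show "bilin (g y) (lie_bracket p q y) (\<xi> y) = 2"
      using br[OF y sU[OF sp] sq pU] pq[OF y] qq[OF yS] by (simp add: bilin_linear)
    show "bilin (g y) (lie_bracket \<xi> p y) (\<xi> y) = 0"
      using br[OF y sU[OF smooth(3)] sU[OF sp] xiU pU(1)] pp[OF yS] gxi[OF yS] by simp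
    show "bilin (g y) (lie_bracket \<xi> q y) (\<xi> y) = 0"
      using br[OF y sU[OF smooth(3)] sq xiU pU(2)] qq[OF yS] gxi[OF yS] by (simp add: bilin_linear)
    show "\<phi> y *v \<xi> y = 0" "\<phi> y *v p y = p y" "\<phi> y *v q y = - q y"
      using phi_xi[OF yS] pp[OF yS] qq[OF yS] by auto
  qed
  show ?thesis
    using xU US adapted by blast
qed

abbreviation "tr_h2 x \<equiv> trace (h_tensor \<phi> \<xi> x ** h_tensor \<phi> \<xi> x)"

text \<open>The frame depends on the point, but ae = -tr h^2 / 2 does not involve it. Rewriting the
  frame results in terms of tr h^2 makes them statements about the chart alone.\<close>

lemma paracontact_local:
  assumes x: "x \<in> S"
  shows "(tr_h2 has_derivative (\<lambda>_. 0)) (at x)"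
    and "tr_h2 x \<noteq> 0 \<Longrightarrow> bilin (g x) X (\<xi> x) = 0 \<Longrightarrow> bilin (g x) X X = 1 \<or> bilin (g x) X X = -1 \<Longrightarrow>
      xi_sectional_curvature g D \<xi> x X = tr_h2 x / 2 - 1 \<and>
      phi_sectional_curvature g D \<phi> x X = 1 - tr_h2 x / 2"
proof -
  obtain U p q where xU: "x \<in> U" and US: "U \<subseteq> S" and ad: "adapted_null_frame U g (local_connection D) \<xi> p q \<phi>"
    using null_frame_exists[OF x] by blast
  interpret F: adapted_null_frame U g "local_connection D" \<xi> p q \<phi> by (rule ad)
  have D: "affine_connection_on S D" using LC by (simp add: levi_civita_on_def)
  have comm: "ricci_operator g (local_connection D) y ** \<phi> y = \<phi> y ** ricci_operator g (local_connection D) y"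
    if "y \<in> U" for y
    using commute[of y] ricci_operator_local_connection[OF D S F.U US that] US that by auto
  interpret C: commuting_null_frame U g "local_connection D" \<xi> p q
    by (rule F.commuting_null_frame[OF comm])
  have "((\<lambda>y. - 2 * (F.a y * F.e y)) has_derivative (\<lambda>_. 0)) (at x)"
    using has_derivative_mult_right[OF C.product_deriv_zero[OF xU], of "- 2"] by simp
  then show "(tr_h2 has_derivative (\<lambda>_. 0)) (at x)"
    by (rule has_derivative_transform_within_open[OF _ F.U xU]) (simp add: F.trace_h_square)
  assume "tr_h2 x \<noteq> 0" and X: "bilin (g x) X (\<xi> x) = 0" "bilin (g x) X X = 1 \<or> bilin (g x) X X = -1"
  then have "F.a x * F.e x \<noteq> 0" by (simp add: F.trace_h_square[OF xU])
  from F.sectional_curvatures[OF comm xU this X]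
  show "xi_sectional_curvature g D \<xi> x X = tr_h2 x / 2 - 1 \<and>
      phi_sectional_curvature g D \<phi> x X = 1 - tr_h2 x / 2"
    by (simp add: F.trace_h_square[OF xU] xi_sectional_curvature_def phi_sectional_curvature_def curvature4_def
        curvature_at_local_connection[OF D S F.U US xU])
qed

end

section \<open>Dependence on the chart\<close>

lemma h_tensor_eq:
  assumes "T differentiable at x" "V differentiable at x"
  shows "h_tensor T V x *v v = (1/2) *\<^sub>R (dir_deriv V T x *v v
    - frechet_derivative V (at x) (T x *v v) + T x *v frechet_derivative V (at x) v)"
  using h_tensor_apply[OF assms, of "\<lambda>_. v"] lie_deriv_endo_eq[OF assms, of "\<lambda>_. v"] by simp

text \<open>The second derivative \<open>H\<close> of the coordinate change enters every derivative
  of the transformed fields. Two of its occurrences cancel directly once T' is moved past the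
  Jacobian, the other two likewise, in both cases by the symmetry of \<open>H\<close>.\<close>

lemma h_tensor_transform:
  fixes \<psi> :: "real ^ 'n \<Rightarrow> real ^ 'n::finite"
  defines "J y \<equiv> matrix (frechet_derivative \<psi> (at y))"
  assumes R: "open R" "x \<in> R" and \<psi>: "smooth_on R \<psi>"
    and V: "smooth_on R V" and T: "smooth_on R T"
    and V': "V' differentiable at (\<psi> x)" and T': "T' differentiable at (\<psi> x)"
    and VV: "\<And>y. y \<in> R \<Longrightarrow> V' (\<psi> y) = J y *v V y"
    and TT: "\<And>y. y \<in> R \<Longrightarrow> T' (\<psi> y) ** J y = J y ** T y"
  shows "h_tensor T' V' (\<psi> x) ** J x = J x ** h_tensor T V x"
proof -
  define F where "F y = frechet_derivative \<psi> (at y)" for y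
  have d\<psi>: "\<psi> differentiable at y" if "y \<in> R" for y
    using smooth_on_differentiable[OF \<psi> that] .
  have lF: "linear (F y)" if "y \<in> R" for y
    using linear_frechet_derivative[OF d\<psi>[OF that]] by (simp add: F_def)
  have JF: "J y *v u = F y u" if "y \<in> R" for y u
    using lF[OF that] by (simp add: J_def F_def)
  have sF: "smooth_on R (\<lambda>y. F y u)" for u
    unfolding F_def by (rule smooth_on_frechet_derivative[OF \<psi>])
  define H where "H w u = dir_deriv (\<lambda>_. w) (\<lambda>y. F y u) x" for w u
  have H: "H w u = H u w" for u w
    using second_derivative_symmetric[OF R(1) \<psi> R(2)] by (simp add: H_def F_def dir_deriv_def)
  have dT: "T differentiable at x" and dV: "V differentiable at x"
    using smooth_on_differentiable[OF T R(2)] smooth_on_differentiable[OF V R(2)] .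
  have comp: "dir_deriv (\<lambda>_. w) (\<lambda>y. f (\<psi> y)) x = frechet_derivative f (at (\<psi> x)) (F x w)"
    if "f differentiable at (\<psi> x)" for f :: "real ^ 'n \<Rightarrow> 'z::real_normed_vector" and w
    using frechet_derivative_compose[OF d\<psi>[OF R(2)] that] by (simp add: dir_deriv_def o_def F_def)
  have dc: "(\<lambda>y. f (\<psi> y)) differentiable at x" if "f differentiable at (\<psi> x)"
    for f :: "real ^ 'n \<Rightarrow> 'z::real_normed_vector"
    using differentiable_compose[OF that d\<psi>[OF R(2)]] .
  have 1: "frechet_derivative V' (at (\<psi> x)) (F x w) = H w (V x) + F x (frechet_derivative V (at x) w)" for w
  proof -
    have "frechet_derivative V' (at (\<psi> x)) (F x w) = dir_deriv (\<lambda>_. w) (\<lambda>y. F y (V y)) x"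
      unfolding comp[OF V', symmetric]
      by (rule dir_deriv_cong[OF R dc[OF V']]) (simp add: VV JF)
    also have "\<dots> = H w (V x) + F x (dir_deriv (\<lambda>_. w) V x)"
      unfolding H_def by (rule dir_deriv_linear_family[OF R V lF sF])
    finally show ?thesis by (simp add: dir_deriv_def)
  qed
  have TF: "T' (\<psi> y) *v F y u = F y (T y *v u)" if "y \<in> R" for y u
    using arg_cong[OF TT[OF that], of "\<lambda>M. M *v u"]
    by (simp add: matrix_vector_mul_assoc[symmetric] JF[OF that])
  \<comment> \<open>Obtained by differentiating the transformation law of \<open>T\<close>, applied
    to a fixed vector \<open>u\<close>, along \<open>V\<close>.\<close>
  have 2: "frechet_derivative T' (at (\<psi> x)) (F x (V x)) *v F x u =
      H (V x) (T x *v u) + F x (dir_deriv V T x *v u) - T' (\<psi> x) *v H (V x) u" for u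
  proof -
    have dF: "(\<lambda>y. F y u) differentiable at x"
      by (rule smooth_on_differentiable[OF sF R(2)])
    have "dir_deriv (\<lambda>_. V x) (\<lambda>y. T' (\<psi> y) *v F y u) x =
        T' (\<psi> x) *v H (V x) u + frechet_derivative T' (at (\<psi> x)) (F x (V x)) *v F x u"
      unfolding H_def comp[OF T', symmetric] by (rule dir_deriv_matrix_vector_mult[OF dc[OF T'] dF])
    moreover have "dir_deriv (\<lambda>_. V x) (\<lambda>y. T' (\<psi> y) *v F y u) x = dir_deriv (\<lambda>_. V x) (\<lambda>y. F y (T y *v u)) x"
    proof (rule dir_deriv_cong[OF R, symmetric])
      show "(\<lambda>y. F y (T y *v u)) differentiable at x"
        by (intro smooth_on_differentiable[OF _ R(2)] smooth_on_linear_family[OF R(1) _ lF sF]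
            smooth_on_matrix_vector_mult R T smooth_on_const)
    qed (simp add: TF)
    moreover have "\<dots> = H (V x) (T x *v u) + F x (dir_deriv (\<lambda>_. V x) (\<lambda>y. T y *v u) x)"
      unfolding H_def
      by (rule dir_deriv_linear_family[OF R _ lF sF]) (intro smooth_on_matrix_vector_mult R T smooth_on_const)
    moreover have "dir_deriv (\<lambda>_. V x) (\<lambda>y. T y *v u) x = dir_deriv V T x *v u"
      using dT by (simp add: dir_deriv_matrix_vector_mult) (simp add: dir_deriv_def)
    ultimately show ?thesis by (simp add: algebra_simps)
  qed
  have "h_tensor T' V' (\<psi> x) *v F x u = F x (h_tensor T V x *v u)" for u
    using R(2)
    by (simp add: h_tensor_eq T' V' dT dV dir_deriv_def[of V'] VV JF 2 TF 1 H[of "V x"]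
        matrix_vector_right_distrib linear_add[OF lF] linear_diff[OF lF] linear_cmul[OF lF])
  then show ?thesis
    using R(2) by (auto simp: matrix_eq matrix_vector_mul_assoc[symmetric] JF)
qed

lemma trace_similar:
  fixes A B P Q :: "real ^ 'n ^ 'n"
  assumes "A ** P = P ** B" "Q ** P = mat 1"
  shows "trace (A ** A) = trace (B ** B)"
proof -
  have PQ: "P ** Q = mat 1" using assms(2) matrix_left_right_inverse by blast
  have "A ** A = P ** (B ** B ** Q)"
    by (metis PQ assms(1) matrix_mul_assoc matrix_mul_rid)
  then have "trace (A ** A) = trace (B ** B ** Q ** P)"
    by (metis trace_mul_sym)
  then show ?thesis
    by (metis assms(2) matrix_mul_assoc matrix_mul_rid)
qed

section \<open>Charts, transition maps and invariance of tr h^2\<close>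

lemma smooth_manifoldD:
  assumes "smooth_manifold M A" "c \<in> A"
  shows "openin M (fst c)" "open (chart_image c)"
    "homeomorphic_map (subtopology M (fst c)) (top_of_set (chart_image c)) (snd c)"
    "fst c \<subseteq> topspace M" "inj_on (snd c) (fst c)"
proof -
  show c: "openin M (fst c)" "open (chart_image c)"
    "homeomorphic_map (subtopology M (fst c)) (top_of_set (chart_image c)) (snd c)"
    using assms by (auto simp: smooth_manifold_def)
  show "fst c \<subseteq> topspace M" using c(1) by (rule openin_subset)
  then show "inj_on (snd c) (fst c)"
    using homeomorphic_imp_injective_map[OF c(3)] by (simp add: Int_absorb1)
qed

lemma open_overlap:
  assumes "smooth_manifold M A" "c \<in> A" "d \<in> A"
  shows "open (overlap c d)"
proof -
  note c = smooth_manifoldD[OF assms(1,2)]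
  have "openin (subtopology M (fst c)) (fst c \<inter> fst d)"
    using smooth_manifoldD(1)[OF assms(1,3)] by (auto simp: openin_subtopology)
  then have "openin (top_of_set (chart_image c)) (overlap c d)"
    using homeomorphic_imp_open_map[OF c(3)] by (auto simp: open_map_def overlap_def)
  then show ?thesis using c(2) openin_open_trans by blast
qed

lemma transition_apply:
  assumes "smooth_manifold M A" "c \<in> A" "m \<in> fst c"
  shows "transition c d (snd c m) = snd d m"
  using smooth_manifoldD(5)[OF assms(1,2)] assms(3) by (simp add: transition_def)

lemma jacobian_inverse:
  assumes M: "smooth_manifold M A" and c: "c \<in> A" and d: "d \<in> A" and x: "x \<in> overlap c d"
  shows "jacobian_at d c (transition c d x) ** jacobian_at c d x = mat 1"
proof -
  have sm: "smooth_on (overlap c d) (transition c d)" "smooth_on (overlap d c) (transition d c)"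
    using M c d by (auto simp: smooth_manifold_def)
  have inv: "transition d c (transition c d y) = y" and mem: "transition c d y \<in> overlap d c"
    if "y \<in> overlap c d" for y
    using that transition_apply[OF M c, of _ d] transition_apply[OF M d, of _ c] by (auto simp: overlap_def)
  have d1: "transition c d differentiable at x"
    by (rule smooth_on_differentiable[OF sm(1) x])
  have d2: "transition d c differentiable at (transition c d x)"
    by (rule smooth_on_differentiable[OF sm(2) mem[OF x]])
  have "frechet_derivative (transition d c \<circ> transition c d) (at x) = frechet_derivative (\<lambda>y. y) (at x)"
    by (rule frechet_derivative_transform_within_open[OF differentiable_chain_at[OF d1 d2]
          open_overlap[OF M c d] x]) (simp add: inv)
  then have "frechet_derivative (transition d c) (at (transition c d x)) \<circ>
      frechet_derivative (transition c d) (at x) = (\<lambda>y. y)"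
    using frechet_derivative_compose[OF d1 d2] by simp
  then show ?thesis
    unfolding jacobian_at_def
    by (subst matrix_compose[symmetric])
      (simp_all add: linear_frechet_derivative d1 d2 matrix_id_mat_1[unfolded id_def])
qed

lemma trace_h_square_invariant:
  assumes M: "smooth_manifold M A" and \<xi>: "vector_field A \<xi>" and \<phi>: "endomorphism_field A \<phi>"
    and c: "c \<in> A" and d: "d \<in> A" and x: "x \<in> overlap c d"
  shows "trace (h_tensor (\<phi> d) (\<xi> d) (transition c d x) ** h_tensor (\<phi> d) (\<xi> d) (transition c d x)) =
    trace (h_tensor (\<phi> c) (\<xi> c) x ** h_tensor (\<phi> c) (\<xi> c) x)"
proof (rule trace_similar[OF _ jacobian_inverse[OF M c d x]])
  have sub: "overlap c d \<subseteq> chart_image c"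
    by (auto simp: overlap_def chart_image_def)
  have mem: "transition c d x \<in> chart_image d"
    using x transition_apply[OF M c, of _ d] by (auto simp: overlap_def chart_image_def)
  show "h_tensor (\<phi> d) (\<xi> d) (transition c d x) ** jacobian_at c d x =
      jacobian_at c d x ** h_tensor (\<phi> c) (\<xi> c) x"
    unfolding jacobian_at_def
  proof (rule h_tensor_transform[OF open_overlap[OF M c d] x])
    show "smooth_on (overlap c d) (transition c d)"
      using M c d by (auto simp: smooth_manifold_def)
    show "smooth_on (overlap c d) (\<xi> c)" "smooth_on (overlap c d) (\<phi> c)"
      using \<xi> \<phi> c by (auto intro!: smooth_on_subset[OF _ sub] simp: vector_field_def endomorphism_field_def)
    show "\<xi> d differentiable at (transition c d x)" "\<phi> d differentiable at (transition c d x)"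
      using \<xi> \<phi> d by (auto intro!: smooth_on_differentiable[OF _ mem] simp: vector_field_def endomorphism_field_def)
    show "\<And>y. y \<in> overlap c d \<Longrightarrow> \<xi> d (transition c d y) = matrix (frechet_derivative (transition c d) (at y)) *v \<xi> c y"
      "\<And>y. y \<in> overlap c d \<Longrightarrow> \<phi> d (transition c d y) ** matrix (frechet_derivative (transition c d) (at y)) =
        matrix (frechet_derivative (transition c d) (at y)) ** \<phi> c y"
      using \<xi> \<phi> c d by (auto simp: vector_field_def endomorphism_field_def jacobian_at_def)
  qed
qed

section \<open>From local to global constancy\<close>

text \<open>The chart functions descend to one function on the manifold. It is locally constant, so
  each of its level sets is open and closed, and connectedness leaves only one nonempty level
  set.\<close>

lemma locally_constant_on_connected_manifold:
  fixes H :: "('a, 'n::finite) chart \<Rightarrow> real ^ 'n \<Rightarrow> real"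
  assumes M: "smooth_manifold M A" and conn: "connected_space M"
    and inv: "\<And>c d x. c \<in> A \<Longrightarrow> d \<in> A \<Longrightarrow> x \<in> overlap c d \<Longrightarrow> H d (transition c d x) = H c x"
    and deriv: "\<And>c x. c \<in> A \<Longrightarrow> x \<in> chart_image c \<Longrightarrow> (H c has_derivative (\<lambda>_. 0)) (at x)"
  shows "\<exists>C. \<forall>c\<in>A. \<forall>x\<in>chart_image c. H c x = C"
proof -
  have cover: "topspace M = (\<Union>c\<in>A. fst c)"
    using M by (simp add: smooth_manifold_def)
  \<comment> \<open>An arbitrary chart around the point is chosen; by \<open>inv\<close> the value
    does not depend on it.\<close>
  define F where "F m = (let c = SOME c. c \<in> A \<and> m \<in> fst c in H c (snd c m))" for m
  have F: "F m = H c (snd c m)" if c: "c \<in> A" and m: "m \<in> fst c" for c m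
  proof -
    define d where "d = (SOME c. c \<in> A \<and> m \<in> fst c)"
    have d: "d \<in> A" "m \<in> fst d"
      using someI[of "\<lambda>c. c \<in> A \<and> m \<in> fst c" c] c m by (auto simp: d_def)
    have "H d (transition c d (snd c m)) = H c (snd c m)"
      by (rule inv) (use c d m in \<open>auto simp: overlap_def\<close>)
    then show ?thesis
      using transition_apply[OF M c m] by (simp add: F_def Let_def flip: d_def)
  qed
  have loc: "\<exists>W. openin M W \<and> m \<in> W \<and> (\<forall>m'\<in>W. F m' = F m)" if m: "m \<in> topspace M" for m
  proof -
    obtain c where c: "c \<in> A" "m \<in> fst c" using m cover by auto
    note ch = smooth_manifoldD[OF M c(1)]
    have "snd c m \<in> chart_image c" using c by (auto simp: chart_image_def)
    then obtain r where r: "r > 0" "ball (snd c m) r \<subseteq> chart_image c"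
      using ch(2) open_contains_ball by blast
    define W where "W = {m' \<in> topspace (subtopology M (fst c)). snd c m' \<in> ball (snd c m) r}"
    have "openin (top_of_set (chart_image c)) (ball (snd c m) r)"
      using r ch(2) by (simp add: openin_open_eq)
    then have "openin (subtopology M (fst c)) W"
      unfolding W_def by (rule openin_continuous_map_preimage[OF homeomorphic_imp_continuous_map[OF ch(3)]])
    then have "openin M W" using ch(1) openin_trans_full by blast
    moreover have "m \<in> W" using c r m by (auto simp: W_def)
    moreover have "F m' = F m" if "m' \<in> W" for m'
    proof -
      have m': "m' \<in> fst c" "snd c m' \<in> ball (snd c m) r" using that by (auto simp: W_def)
      have "H c (snd c m') = H c (snd c m)"
      \<comment> \<open>A ball is convex, so a zero derivative on it forces constancy; the chart
        image itself need not be connected.\<close>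
      proof (rule has_derivative_zero_unique[of "ball (snd c m) r"])
        show "(H c has_derivative (\<lambda>_. 0)) (at x within ball (snd c m) r)" if "x \<in> ball (snd c m) r" for x
          using deriv[OF c(1)] r(2) that by (blast intro: has_derivative_at_withinI)
      qed (use r(1) m' in auto)
      then show ?thesis using F[OF c(1)] c(2) m' by simp
    qed
    ultimately show ?thesis by blast
  qed
  have op: "openin M {m \<in> topspace M. P (F m)}" for P
  proof (subst openin_subopen, intro ballI)
    fix m assume m: "m \<in> {m \<in> topspace M. P (F m)}"
    then obtain W where "openin M W" "m \<in> W" "\<forall>m'\<in>W. F m' = F m" using loc by blast
    then show "\<exists>T. openin M T \<and> m \<in> T \<and> T \<subseteq> {m \<in> topspace M. P (F m)}"
      using m openin_subset by (intro exI[of _ W]) fastforce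
  qed
  have const: "F m = F m0" if m: "m \<in> topspace M" "m0 \<in> topspace M" for m m0
  proof -
    let ?T = "{m \<in> topspace M. F m = F m0}"
    have "topspace M - ?T = {m \<in> topspace M. F m \<noteq> F m0}" by auto
    then have "closedin M ?T"
      using op[of "\<lambda>v. v \<noteq> F m0"] by (simp add: closedin_def)
    then have "?T = topspace M"
      using conn op[of "\<lambda>v. v = F m0"] m unfolding connected_space_clopen_in by blast
    then show ?thesis using m by auto
  qed
  have eq: "H c x = H d y" if c: "c \<in> A" "x \<in> chart_image c" and d: "d \<in> A" "y \<in> chart_image d" for c d x y
  proof -
    obtain m m' where "m \<in> fst c" "x = snd c m" "m' \<in> fst d" "y = snd d m'"
      using c(2) d(2) by (auto simp: chart_image_def)
    then show ?thesis
      using F[OF c(1)] F[OF d(1)] const[of m m'] smooth_manifoldD(4)[OF M c(1)]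
        smooth_manifoldD(4)[OF M d(1)] by auto
  qed
  show ?thesis
  \<comment> \<open>The manifold may be empty; in that case there is no value to pick, and any
    constant serves.\<close>
  proof (cases "\<exists>c\<in>A. chart_image c \<noteq> {}")
    case True
    then obtain d y where "d \<in> A" "y \<in> chart_image d" by blast
    then show ?thesis by (intro exI[of _ "H d y"] ballI eq)
  qed auto
qed

section \<open>Transfer to the manifold and conclusion\<close>

lemma paracontact_chart:
  assumes M: "smooth_manifold M A" and P: "paracontact_metric_structure A \<phi> \<xi> \<eta> g"
    and L: "levi_civita_connection A g D"
    and Q: "\<forall>c\<in>A. \<forall>x\<in>chart_image c.
           ricci_operator (g c) (D c) x ** \<phi> c x = \<phi> c x ** ricci_operator (g c) (D c) x"
    and c: "c \<in> A"
  shows "paracontact_chart (chart_image c) (\<phi> c) (g c) (\<xi> c) (\<eta> c) (D c)"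
proof -
  note defs = paracontact_metric_structure_def paracontact_form_def characteristic_field_def
    pseudo_riemannian_metric_def vector_field_def one_form_def endomorphism_field_def
  have field: "characteristic_field A \<eta> \<xi>" "pseudo_riemannian_metric A g" "endomorphism_field A \<phi>" "one_form A \<eta>"
    using P by (auto simp: paracontact_metric_structure_def paracontact_form_def)
  have str: "ext_deriv (\<eta> c) X Y x = bilin (g c x) (X x) (\<phi> c x *v Y x)"
     "\<eta> c x \<bullet> X x = bilin (g c x) (X x) (\<xi> c x)"
     "\<phi> c x *v (\<phi> c x *v X x) = X x - (\<eta> c x \<bullet> X x) *\<^sub>R \<xi> c x"
    if "smooth_on (chart_image c) X" "smooth_on (chart_image c) Y" "x \<in> chart_image c" for X Y x
    using P c that by (auto simp: paracontact_metric_structure_def)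
  show ?thesis
  proof
    show "open (chart_image c)" using smooth_manifoldD(2)[OF M c] .
    show "smooth_on (chart_image c) (\<phi> c)" "smooth_on (chart_image c) (g c)"
      "smooth_on (chart_image c) (\<xi> c)" "smooth_on (chart_image c) (\<eta> c)"
      using field c by (auto simp: defs)
    show "levi_civita_on (chart_image c) (g c) (D c)"
      using L c by (simp add: levi_civita_connection_def)
  next
    fix x assume x: "x \<in> chart_image c"
    show "bilin (g c x) u v = bilin (g c x) v u" for u v
      using field(2) c x by (auto simp: pseudo_riemannian_metric_def)
    show "v = 0" if "\<And>w. bilin (g c x) v w = 0" for v
      using field(2) c x that by (auto simp: pseudo_riemannian_metric_def)
    show "\<eta> c x \<bullet> \<xi> c x = 1" "ext_deriv (\<eta> c) (\<xi> c) (\<lambda>_. v) x = 0" for v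
      using field(1) c x by (auto simp: characteristic_field_def)
    show "ext_deriv (\<eta> c) (\<lambda>_. u) (\<lambda>_. v) x = bilin (g c x) u (\<phi> c x *v v)" for u v
      using str(1)[of "\<lambda>_. u" "\<lambda>_. v" x] x by simp
    show "\<eta> c x \<bullet> u = bilin (g c x) u (\<xi> c x)"
      "\<phi> c x *v (\<phi> c x *v u) = u - (\<eta> c x \<bullet> u) *\<^sub>R \<xi> c x" for u
      using str(2,3)[of "\<lambda>_. u" "\<lambda>_. u" x] x by simp_all
    show "ricci_operator (g c) (D c) x ** \<phi> c x = \<phi> c x ** ricci_operator (g c) (D c) x"
      using Q c x by blast
  qed
qed

theorem theorem3p4:
  fixes M :: "'a topology"
    and A :: "('a, 3) chart set"
    and \<phi> g :: "('a, 3) chart \<Rightarrow> real ^ 3 \<Rightarrow> real ^ 3 ^ 3"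
    and \<xi> \<eta> :: "('a, 3) chart \<Rightarrow> real ^ 3 \<Rightarrow> real ^ 3"
    and D :: "('a, 3) chart \<Rightarrow> 3 connection"
  assumes "smooth_manifold M A" and "connected_space M"
    and "paracontact_metric_structure A \<phi> \<xi> \<eta> g"
    and "levi_civita_connection A g D"
    and "\<forall>c\<in>A. \<forall>x\<in>chart_image c.
           ricci_operator (g c) (D c) x ** \<phi> c x = \<phi> c x ** ricci_operator (g c) (D c) x"
  shows "(\<forall>c\<in>A. \<forall>x\<in>chart_image c.
            trace (h_tensor (\<phi> c) (\<xi> c) x ** h_tensor (\<phi> c) (\<xi> c) x) = 0)
       \<or> flat_connection A D
       \<or> (\<exists>k::real. k \<noteq> -1 \<and>
            (\<forall>c\<in>A. \<forall>x\<in>chart_image c. \<forall>X :: real ^ 3.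
               bilin (g c x) X (\<xi> c x) = 0 \<and> (bilin (g c x) X X = 1 \<or> bilin (g c x) X X = -1) \<longrightarrow>
               xi_sectional_curvature (g c) (D c) (\<xi> c) x X = k \<and>
               phi_sectional_curvature (g c) (D c) (\<phi> c) x X = -k))"
proof -
  let ?tr = "\<lambda>c x. trace (h_tensor (\<phi> c) (\<xi> c) x ** h_tensor (\<phi> c) (\<xi> c) x)"
  note chart = paracontact_chart[OF assms(1,3-5)]
  have "vector_field A \<xi>" "endomorphism_field A \<phi>"
    using assms(3) by (auto simp: paracontact_metric_structure_def characteristic_field_def)
  note inv = trace_h_square_invariant[OF assms(1) this]
  obtain C where C: "\<And>c x. c \<in> A \<Longrightarrow> x \<in> chart_image c \<Longrightarrow> ?tr c x = C"
    using locally_constant_on_connected_manifold[OF assms(1,2), of ?tr, OF inv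
        paracontact_chart.paracontact_local(1)[OF chart]] by blast
  show ?thesis
  proof (cases "C = 0")
    case True
    then show ?thesis using C by blast
  next
    case False
    have "xi_sectional_curvature (g c) (D c) (\<xi> c) x X = C / 2 - 1 \<and>
        phi_sectional_curvature (g c) (D c) (\<phi> c) x X = - (C / 2 - 1)"
      if "c \<in> A" "x \<in> chart_image c" "bilin (g c x) X (\<xi> c x) = 0"
        "bilin (g c x) X X = 1 \<or> bilin (g c x) X X = -1" for c x X
      using paracontact_chart.paracontact_local(2)[OF chart, of c x X] that False C by auto
    with False show ?thesis
      \<comment> \<open>Here k = C/2 - 1, with C the constant value of tr h^2; k differs from -1
        precisely because C is not 0.\<close>
      by (intro disjI2 exI[of _ "C / 2 - 1"]) auto
  qed
qed

end
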